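(* Let $n\ge1$, let $D=\{(\alpha,\beta)\in\mathbb{R}^2\mid\alpha=\beta\}$, and let $F\colon\mathbb{R}\times(\mathbb{R}^2\setminus D)\times\mathbb{R}^{2n}\to\mathbb{R}^n$ be a mapping. Then $F$ is the smooth dependence of the solution on Neumann conditions for some smooth N-solvable equation $\ddot{x}=f(\tau,x,\dot{x})$ (with $f\colon\mathbb{R}\times\mathbb{R}^n\times\mathbb{R}^n\to\mathbb{R}^n$ smooth) if and only if the following three conditions hold: (i) for all $\tau,\gamma,\delta,\alpha,\beta\in\mathbb{R}$ with $\alpha\ne\beta$, $\gamma\ne\delta$ and all $a,b\in\mathbb{R}^n$, $F(\tau,\alpha,\beta,a,b)=F(\tau,\gamma,\delta,F(\gamma,\alpha,\beta,a,b),F(\delta,\alpha,\beta,a,b))$; (ii) for all $\alpha\ne\beta$ and $a,b\in\mathbb{R}^n$, $F(\alpha,\alpha,\beta,a,b)=a$ and $F(\beta,\alpha,\beta,a,b)=b$; (iii) the mapping $\mathbb{R}\times(\mathbb{R}^2\setminus D)\times\mathbb{R}^{2n}\ni(\tau,\alpha,\beta,a,v)\mapsto F(\tau,\alpha,\beta,a,a+v(\beta-\alpha))\in\mathbb{R}^n$ has a smooth extension $S$ to $\mathbb{R}^{2n+3}$.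
   Context: Smooth means $C^\infty$. For a smooth $f\colon\mathbb{R}\times\mathbb{R}^n\times\mathbb{R}^n\to\mathbb{R}^n$, a complete solution of $\ddot{x}=f(\tau,x,\dot{x})$ is a solution $x$ defined on all of $\mathbb{R}$. The equation is N-solvable if for every $\alpha,\beta\in\mathbb{R}$ with $\alpha\neq\beta$ and every $a,b\in\mathbb{R}^n$ there exists a unique complete solution with $x(\alpha)=a$, $x(\beta)=b$ (Neumann conditions). A mapping $F\colon\mathbb{R}\times(\mathbb{R}^2\setminus D)\times\mathbb{R}^{2n}\to\mathbb{R}^n$ is called a dependence of the solution on Neumann conditions for this equation if $F(\tau,\alpha,\beta,x(\alpha),x(\beta))=x(\tau)$ for all $\alpha\neq\beta$, all $\tau\in\mathbb{R}$ and every complete solution $x$ of the equation; it is a smooth dependence if moreover $F$ is smooth. *)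

theory Defs
  imports "HOL-Analysis.Analysis"
begin

fun Ck_on :: "nat \<Rightarrow> 'a::euclidean_space set \<Rightarrow> ('a \<Rightarrow> 'b::real_normed_vector) \<Rightarrow> bool" where
  "Ck_on 0 S f = continuous_on S f"
| "Ck_on (Suc k) S f = (f differentiable_on S \<and>
     (\<forall>i\<in>Basis. Ck_on k S (\<lambda>x. frechet_derivative f (at x) i)))"

definition smooth_on :: "'a::euclidean_space set \<Rightarrow> ('a \<Rightarrow> 'b::real_normed_vector) \<Rightarrow> bool" where
  "smooth_on S f \<longleftrightarrow> (\<forall>k. Ck_on k S f)"

definition complete_solution ::
  "(real \<times> (real^'n) \<times> (real^'n) \<Rightarrow> real^'n) \<Rightarrow> (real \<Rightarrow> real^'n) \<Rightarrow> bool" where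
  "complete_solution f x \<longleftrightarrow> (\<exists>x'. \<forall>t.
      (x has_vector_derivative x' t) (at t) \<and>
      (x' has_vector_derivative f (t, x t, x' t)) (at t))"

definition N_solvable :: "(real \<times> (real^'n) \<times> (real^'n) \<Rightarrow> real^'n) \<Rightarrow> bool" where
  "N_solvable f \<longleftrightarrow> (\<forall>\<alpha> \<beta> a b. \<alpha> \<noteq> \<beta> \<longrightarrow>
      (\<exists>!x. complete_solution f x \<and> x \<alpha> = a \<and> x \<beta> = b))"

text \<open>F is only meaningful off the diagonal alpha = beta.\<close>
definition dependence ::
  "(real \<Rightarrow> real \<Rightarrow> real \<Rightarrow> real^'n \<Rightarrow> real^'n \<Rightarrow> real^'n)
   \<Rightarrow> (real \<times> (real^'n) \<times> (real^'n) \<Rightarrow> real^'n) \<Rightarrow> bool" where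
  "dependence F f \<longleftrightarrow> (\<forall>x \<alpha> \<beta> \<tau>. complete_solution f x \<and> \<alpha> \<noteq> \<beta> \<longrightarrow>
      F \<tau> \<alpha> \<beta> (x \<alpha>) (x \<beta>) = x \<tau>)"

definition smooth_dependence ::
  "(real \<Rightarrow> real \<Rightarrow> real \<Rightarrow> real^'n \<Rightarrow> real^'n \<Rightarrow> real^'n)
   \<Rightarrow> (real \<times> (real^'n) \<times> (real^'n) \<Rightarrow> real^'n) \<Rightarrow> bool" where
  "smooth_dependence F f \<longleftrightarrow> dependence F f \<and>
     smooth_on {(\<tau>, \<alpha>, \<beta>, a, b). \<alpha> \<noteq> \<beta>}
       (\<lambda>(\<tau>::real, \<alpha>::real, \<beta>::real, a::real^'n, b::real^'n). F \<tau> \<alpha> \<beta> a b)"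

end

(* From (i)-(iii) to the equation: put f(t,x,v) = (second tau-derivative of S)(t,t,t,x,v).
   Letting delta tend to gamma in (i) shows that z = S(.,p) satisfies z(tau) = S(tau,s,s,z(s),z'(s))
   for all s, hence solves the equation. For an arbitrary solution y the curve
   s |-> S(tau,s,s,y(s),y'(s)) has derivative zero, so y is one of these z.

   From the equation to S: with beta = alpha + 1, the map sending an endpoint value w to the initial
   velocity of the corresponding solution is injective with injective derivative (Gronwall), and
   surjective (open and closed image). Its inverse is smooth and gives a smooth global flow Phi
   without the theorem on smooth dependence on initial conditions. The mean velocity
   (Phi(beta,alpha,a,w) - a)/(beta - alpha), written as an integral, is smooth also at alpha = beta,
   where it equals w. It is bijective in w with injective derivative, so its inverse W is smooth,
   and S(tau,alpha,beta,a,v) = Phi(tau,alpha,a,W(alpha,beta,a,v)). *)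

theory Submission
  imports Defs
begin

section \<open>Calculus of smooth maps\<close>

text \<open>Agreement on an open set passes to the full derivatives
  \<open>frechet_derivative f (at x)\<close>, since these only see a neighbourhood of
  \<open>x\<close>. The induction on the order then runs through the derivatives.\<close>

lemma Ck_on_cong:
  assumes "open S" "\<And>x. x \<in> S \<Longrightarrow> f x = g x" "Ck_on k S f"
  shows "Ck_on k S g"
  using assms(2,3)
proof (induction k arbitrary: f g)
  case 0
  then show ?case by (simp cong: continuous_on_cong)
next
  case (Suc k)
  have der: "(f has_derivative frechet_derivative f (at x)) (at x)" if "x \<in> S" for x
    using Suc.prems(2) \<open>open S\<close> that
    by (metis Ck_on.simps(2) at_within_open differentiable_on_def frechet_derivative_works)
  have derg: "(g has_derivative frechet_derivative f (at x)) (at x)" if "x \<in> S" for x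
    using has_derivative_transform_within_open[OF der[OF that] \<open>open S\<close> that] Suc.prems(1) by auto
  have "frechet_derivative g (at x) = frechet_derivative f (at x)" if "x \<in> S" for x
    using derg[OF that] frechet_derivative_at by metis
  then have "Ck_on k S (\<lambda>x. frechet_derivative g (at x) i)" if "i \<in> Basis" for i
    using Suc.IH[of "\<lambda>x. frechet_derivative f (at x) i"] Suc.prems(2) that by auto
  moreover have "g differentiable_on S"
    using derg unfolding differentiable_on_def
    by (meson differentiable_at_withinI differentiable_def)
  ultimately show ?case by simp
qed

text \<open>Uniqueness of the derivative allows any explicit family \<open>f'\<close> in place of
  \<open>frechet_derivative\<close>. The closure properties below follow one pattern: supply
  \<open>f'\<close> by the relevant differentiation rule and apply the induction hypothesis to
  it.\<close>

lemma Ck_on_SucI: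
  assumes "open S" "\<And>x. x \<in> S \<Longrightarrow> (f has_derivative f' x) (at x)"
    "\<And>i. i \<in> Basis \<Longrightarrow> Ck_on k S (\<lambda>x. f' x i)"
  shows "Ck_on (Suc k) S f"
proof -
  have "frechet_derivative f (at x) = f' x" if "x \<in> S" for x
    using assms(2)[OF that] frechet_derivative_at by metis
  then have "Ck_on k S (\<lambda>x. frechet_derivative f (at x) i)" if "i \<in> Basis" for i
    using Ck_on_cong[OF assms(1) _ assms(3)[OF that]] by auto
  moreover have "f differentiable_on S"
    using assms(2) unfolding differentiable_on_def
    by (meson differentiable_at_withinI differentiable_def)
  ultimately show ?thesis by simp
qed

lemma Ck_on_SucD:
  assumes "open S" "Ck_on (Suc k) S f"
  shows "x \<in> S \<Longrightarrow> (f has_derivative frechet_derivative f (at x)) (at x)"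
    and "i \<in> Basis \<Longrightarrow> Ck_on k S (\<lambda>x. frechet_derivative f (at x) i)"
proof -
  show "(f has_derivative frechet_derivative f (at x)) (at x)" if "x \<in> S"
    using assms that
    by (metis Ck_on.simps(2) at_within_open differentiable_on_def frechet_derivative_works)
qed (use assms in auto)

lemma Ck_on_Suc_imp: 
  assumes "open S" "Ck_on (Suc k) S f"
  shows "Ck_on k S f"
  using assms(2)
proof (induction k arbitrary: f)
  case 0
  then show ?case by (simp add: differentiable_imp_continuous_on)
next
  case (Suc k)
  show ?case
    by (rule Ck_on_SucI[OF assms(1) Ck_on_SucD(1)[OF assms(1) Suc.prems]])
       (auto intro: Suc.IH Ck_on_SucD(2)[OF assms(1) Suc.prems])
qed

lemma Ck_on_continuous: "open S \<Longrightarrow> Ck_on k S f \<Longrightarrow> continuous_on S f"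
proof (induction k)
  case (Suc k)
  then show ?case by (simp add: differentiable_imp_continuous_on)
qed simp

lemma Ck_on_const: 
  assumes "open S"
  shows "Ck_on k S (\<lambda>x. c)"
proof (induction k arbitrary: c)
  case (Suc k)
  show ?case
    by (rule Ck_on_SucI[where f' = "\<lambda>x i. 0"]) (use assms Suc in auto)
qed simp

lemma Ck_on_bounded_linear:
  assumes "open S" "bounded_linear h" "Ck_on k S f"
  shows "Ck_on k S (\<lambda>x. h (f x))"
  using assms(3)
proof (induction k arbitrary: f)
  case 0
  then show ?case
    using assms(2) by (simp add: bounded_linear.continuous_on)
next
  case (Suc k)
  show ?case
    by (rule Ck_on_SucI[where f' = "\<lambda>x i. h (frechet_derivative f (at x) i)"])
       (use assms(1) Suc.IH Ck_on_SucD[OF assms(1) Suc.prems] in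
         \<open>auto intro: bounded_linear.has_derivative[OF assms(2)]\<close>)
qed

lemma Ck_on_id:
  assumes "open S"
  shows "Ck_on k S (\<lambda>x. x)"
proof (cases k)
  case (Suc l)
  show ?thesis unfolding Suc
    by (rule Ck_on_SucI[where f' = "\<lambda>x i. i"]) (use assms in \<open>auto intro: Ck_on_const\<close>)
qed simp

lemma Ck_on_add:
  assumes "open S" "Ck_on k S f" "Ck_on k S g"
  shows "Ck_on k S (\<lambda>x. f x + g x)"
  using assms(2,3)
proof (induction k arbitrary: f g)
  case 0
  then show ?case by (simp add: continuous_on_add)
next
  case (Suc k)
  show ?case
    by (rule Ck_on_SucI[where f' = "\<lambda>x i. frechet_derivative f (at x) i + frechet_derivative g (at x) i"])
       (use assms(1) Suc.IH Ck_on_SucD[OF assms(1) Suc.prems(1)] Ck_on_SucD[OF assms(1) Suc.prems(2)] in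
         \<open>auto intro: has_derivative_add\<close>)
qed

lemma (in bounded_bilinear) Ck_on:
  assumes "open S" "Ck_on k S f" "Ck_on k S g"
  shows "Ck_on k S (\<lambda>x. prod (f x) (g x))"
  using assms(2,3)
proof (induction k arbitrary: f g)
  case 0
  then show ?case by (simp add: continuous_on)
next
  case (Suc k)
  \<comment> \<open>The product rule leaves one factor undifferentiated, so order \<open>k\<close>
    is required of \<open>f\<close> and \<open>g\<close> themselves as well as of their
    derivatives.\<close>
  have "Ck_on k S f" "Ck_on k S g"
    using Suc.prems assms(1) Ck_on_Suc_imp by blast+
  with Suc show ?case
    by (intro Ck_on_SucI[where f' = "\<lambda>x i. prod (f x) (frechet_derivative g (at x) i)
             + prod (frechet_derivative f (at x) i) (g x)"] assms(1))
       (use assms(1) Suc.IH Ck_on_SucD[OF assms(1) Suc.prems(1)] Ck_on_SucD[OF assms(1) Suc.prems(2)] in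
         \<open>auto intro!: FDERIV Ck_on_add\<close>)
qed

lemma Ck_on_sum:
  assumes "open S" "\<And>i. i \<in> I \<Longrightarrow> Ck_on k S (f i)"
  shows "Ck_on k S (\<lambda>x. \<Sum>i\<in>I. f i x)"
  using assms(2)
  by (induction I rule: infinite_finite_induct) (auto intro: assms(1) Ck_on_const Ck_on_add)

lemma Ck_on_prod:
  fixes f :: "'i \<Rightarrow> 'a::euclidean_space \<Rightarrow> real"
  assumes "open S" "\<And>i. i \<in> I \<Longrightarrow> Ck_on k S (f i)"
  shows "Ck_on k S (\<lambda>x. \<Prod>i\<in>I. f i x)"
  using assms(2)
  by (induction I rule: infinite_finite_induct)
     (auto intro: assms(1) Ck_on_const bounded_bilinear.Ck_on[OF bounded_bilinear_mult])

text \<open>In the chain rule the point \<open>x\<close> enters both the base point and the argument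
  of the derivative of \<open>g\<close>. Expanding the argument in the basis separates the two: the
  sum contains only products of scalar components of the derivative of \<open>f\<close> with maps
  \<open>frechet_derivative g (at (f x)) j\<close> for fixed \<open>j\<close>, to which the
  induction hypothesis applies.\<close>

lemma Ck_on_compose:
  fixes f :: "'a::euclidean_space \<Rightarrow> 'b::euclidean_space" and g :: "'b \<Rightarrow> 'c::real_normed_vector"
  assumes "open S" "open T" "f ` S \<subseteq> T" "Ck_on k S f" "Ck_on k T g"
  shows "Ck_on k S (\<lambda>x. g (f x))"
  using assms(4,5)
proof (induction k arbitrary: g)
  case 0
  then show ?case using assms(3) continuous_on_compose2[of T g S f] by simp
next
  case (Suc k)
  note f = Ck_on_SucD[OF assms(1) Suc.prems(1)] and g = Ck_on_SucD[OF assms(2) Suc.prems(2)]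
  have der: "((\<lambda>x. g (f x)) has_derivative
       (\<lambda>h. frechet_derivative g (at (f x)) (frechet_derivative f (at x) h))) (at x)" if "x \<in> S" for x
    using has_derivative_compose[OF f(1)[OF that] g(1)] that assms(3) by blast
  have eq: "frechet_derivative g (at (f x)) (frechet_derivative f (at x) i)
     = (\<Sum>j\<in>Basis. (frechet_derivative f (at x) i \<bullet> j) *\<^sub>R frechet_derivative g (at (f x)) j)"
    if "x \<in> S" for x i
  proof -
    have "f x \<in> T" using that assms(3) by blast
    then have "linear (frechet_derivative g (at (f x)))"
      using g(1) has_derivative_linear by blast
    then have "frechet_derivative g (at (f x)) (\<Sum>j\<in>Basis. (w \<bullet> j) *\<^sub>R j)
       = (\<Sum>j\<in>Basis. (w \<bullet> j) *\<^sub>R frechet_derivative g (at (f x)) j)" for w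
      by (simp add: linear_sum linear_scale)
    from this[of "frechet_derivative f (at x) i"] show ?thesis
      by (simp only: euclidean_representation)
  qed
  show ?case
  proof (rule Ck_on_SucI[OF assms(1) der])
    fix i :: 'a assume i: "i \<in> Basis"
    have "Ck_on k S f" using Suc.prems assms(1) Ck_on_Suc_imp by blast
    then have "Ck_on k S (\<lambda>x. frechet_derivative g (at (f x)) j)" if "j \<in> Basis" for j
      using Suc.IH[OF _ g(2)[OF that]] by blast
    then have "Ck_on k S (\<lambda>x. \<Sum>j\<in>Basis. (frechet_derivative f (at x) i \<bullet> j) *\<^sub>R frechet_derivative g (at (f x)) j)"
      by (intro Ck_on_sum[OF assms(1)] bounded_bilinear.Ck_on[OF bounded_bilinear_scaleR assms(1)]
          Ck_on_bounded_linear[OF assms(1) bounded_linear_inner_left f(2)[OF i]])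
    then show "Ck_on k S (\<lambda>x. frechet_derivative g (at (f x)) (frechet_derivative f (at x) i))"
      by (rule Ck_on_cong[OF assms(1), rotated]) (simp add: eq)
  qed
qed

lemma Ck_on_inverse:
  fixes f :: "'a::euclidean_space \<Rightarrow> real"
  assumes "open S" "\<And>x. x \<in> S \<Longrightarrow> f x \<noteq> 0" "Ck_on k S f"
  shows "Ck_on k S (\<lambda>x. inverse (f x))"
  using assms(3)
proof (induction k)
  case 0
  then show ?case using assms(2) by (auto intro: continuous_on_inverse)
next
  case (Suc k)
  note f = Ck_on_SucD[OF assms(1) Suc.prems(1)]
  have *: "Ck_on k S (\<lambda>x. inverse (f x))"
    using Suc assms(1) Ck_on_Suc_imp by blast
  show ?case
    by (rule Ck_on_SucI[OF assms(1) Deriv.has_derivative_inverse[OF assms(2) f(1)]])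
       (auto intro!: Ck_on_bounded_linear[OF assms(1) bounded_linear_minus[OF bounded_linear_ident]] f * assms(1)
         bounded_bilinear.Ck_on[OF bounded_bilinear_mult])
qed

lemma Ck_on_Pair:
  fixes f :: "'a::euclidean_space \<Rightarrow> 'b::real_normed_vector" and g :: "'a \<Rightarrow> 'c::real_normed_vector"
  assumes "open S" "Ck_on k S f" "Ck_on k S g"
  shows "Ck_on k S (\<lambda>x. (f x, g x))"
proof -
  have "bounded_linear (\<lambda>y::'b. (y, 0::'c))" "bounded_linear (\<lambda>y::'c. (0::'b, y))"
    by (auto intro!: bounded_linear_Pair bounded_linear_ident bounded_linear_zero)
  then have "Ck_on k S (\<lambda>x. (f x, 0) + (0, g x))"
    using assms by (intro Ck_on_add Ck_on_bounded_linear[where h="\<lambda>y::'b. (y, 0::'c)"] Ck_on_bounded_linear[where h="\<lambda>y::'c. (0::'b, y)"])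
  then show ?thesis by simp
qed

lemma Ck_on_vec_lambda:
  fixes f :: "'n::finite \<Rightarrow> 'a::euclidean_space \<Rightarrow> real"
  assumes "open S" "\<And>i. Ck_on k S (f i)"
  shows "Ck_on k S (\<lambda>x. \<chi> i. f i x)"
proof -
  have "Ck_on k S (\<lambda>x. \<Sum>i\<in>UNIV. f i x *\<^sub>R (axis i 1 :: real^'n))"
    by (intro Ck_on_sum assms bounded_bilinear.Ck_on[OF bounded_bilinear_scaleR] Ck_on_const)
  moreover have "(\<Sum>i\<in>UNIV. f i x *\<^sub>R (axis i 1 :: real^'n)) = (\<chi> i. f i x)" for x
    using basis_expansion[of "\<chi> i. f i x"] by (simp add: scalar_mult_eq_scaleR)
  ultimately show ?thesis by simp
qed

lemma Ck_on_det:
  fixes A :: "'a::euclidean_space \<Rightarrow> real^'n^'n"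
  assumes "open S" "\<And>i j. Ck_on k S (\<lambda>x. A x $ i $ j)"
  shows "Ck_on k S (\<lambda>x. det (A x))"
  unfolding det_def
  by (intro Ck_on_sum[OF assms(1)] bounded_bilinear.Ck_on[OF bounded_bilinear_mult assms(1)]
      Ck_on_const[OF assms(1)] Ck_on_prod[OF assms])

section \<open>Closure properties of infinitely differentiable maps\<close>

named_theorems smooth_intros

lemma smooth_onD: "smooth_on S f \<Longrightarrow> Ck_on k S f"
  by (simp add: smooth_on_def)

lemma smooth_on_cong:
  assumes "open S" "\<And>x. x \<in> S \<Longrightarrow> f x = g x" "smooth_on S f"
  shows "smooth_on S g"
  using Ck_on_cong[OF assms(1,2)] assms(3) by (auto simp: smooth_on_def)

lemma smooth_on_const [smooth_intros]: "open S \<Longrightarrow> smooth_on S (\<lambda>x. c)"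
  by (simp add: smooth_on_def Ck_on_const)

lemma smooth_on_id [smooth_intros]: "open S \<Longrightarrow> smooth_on S (\<lambda>x. x)"
  by (simp add: smooth_on_def Ck_on_id)

lemma smooth_on_bounded_linear:
  "open S \<Longrightarrow> bounded_linear h \<Longrightarrow> smooth_on S f \<Longrightarrow> smooth_on S (\<lambda>x. h (f x))"
  by (simp add: smooth_on_def Ck_on_bounded_linear)

lemma smooth_on_fst [smooth_intros]: "open S \<Longrightarrow> smooth_on S f \<Longrightarrow> smooth_on S (\<lambda>x. fst (f x))"
  and smooth_on_snd [smooth_intros]: "open S \<Longrightarrow> smooth_on S f \<Longrightarrow> smooth_on S (\<lambda>x. snd (f x))"
  by (auto intro: smooth_on_bounded_linear bounded_linear_fst bounded_linear_snd)

lemma smooth_on_Pair [smooth_intros]: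
  "open S \<Longrightarrow> smooth_on S f \<Longrightarrow> smooth_on S g \<Longrightarrow> smooth_on S (\<lambda>x. (f x, g x))"
  by (simp add: smooth_on_def Ck_on_Pair)

lemma smooth_on_add [smooth_intros]:
  "open S \<Longrightarrow> smooth_on S f \<Longrightarrow> smooth_on S g \<Longrightarrow> smooth_on S (\<lambda>x. f x + g x)"
  by (simp add: smooth_on_def Ck_on_add)

lemma smooth_on_diff [smooth_intros]:
  "open S \<Longrightarrow> smooth_on S f \<Longrightarrow> smooth_on S g \<Longrightarrow> smooth_on S (\<lambda>x. f x - g x)"
  using smooth_on_add[of S f "\<lambda>x. - g x"]
    smooth_on_bounded_linear[of S "\<lambda>x. - x" g, OF _ bounded_linear_minus[OF bounded_linear_ident]] by auto

lemma smooth_on_scaleR [smooth_intros]: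
  "open S \<Longrightarrow> smooth_on S f \<Longrightarrow> smooth_on S g \<Longrightarrow> smooth_on S (\<lambda>x. f x *\<^sub>R g x)"
  by (simp add: smooth_on_def bounded_bilinear.Ck_on[OF bounded_bilinear_scaleR])

lemma smooth_on_mult [smooth_intros]:
  fixes f g :: "'a::euclidean_space \<Rightarrow> 'b::real_normed_algebra"
  shows "open S \<Longrightarrow> smooth_on S f \<Longrightarrow> smooth_on S g \<Longrightarrow> smooth_on S (\<lambda>x. f x * g x)"
  by (simp add: smooth_on_def bounded_bilinear.Ck_on[OF bounded_bilinear_mult])

lemma smooth_on_inverse [smooth_intros]:
  fixes f :: "'a::euclidean_space \<Rightarrow> real"
  shows "open S \<Longrightarrow> (\<And>x. x \<in> S \<Longrightarrow> f x \<noteq> 0) \<Longrightarrow> smooth_on S f \<Longrightarrow> smooth_on S (\<lambda>x. inverse (f x))"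
  by (simp add: smooth_on_def Ck_on_inverse)

lemma smooth_on_compose:
  fixes f :: "'a::euclidean_space \<Rightarrow> 'b::euclidean_space" and g :: "'b \<Rightarrow> 'c::real_normed_vector"
  assumes "smooth_on T g" "open T" "open S" "smooth_on S f" "\<And>x. x \<in> S \<Longrightarrow> f x \<in> T"
  shows "smooth_on S (\<lambda>x. g (f x))"
  using Ck_on_compose[of S T f _ g] assms by (auto simp: smooth_on_def)

lemma smooth_on_has_derivative:
  "smooth_on S f \<Longrightarrow> open S \<Longrightarrow> x \<in> S \<Longrightarrow> (f has_derivative frechet_derivative f (at x)) (at x)"
  using Ck_on_SucD(1) smooth_onD by blast

lemma smooth_on_sum:
  "open S \<Longrightarrow> (\<And>i. i \<in> I \<Longrightarrow> smooth_on S (f i)) \<Longrightarrow> smooth_on S (\<lambda>x. \<Sum>i\<in>I. f i x)"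
  by (simp add: smooth_on_def Ck_on_sum)

text \<open>\<open>Ck_on\<close> only speaks of directions in \<open>Basis\<close>; linearity of the
  derivative carries this over to every fixed direction \<open>w\<close>.\<close>

lemma smooth_on_frechet_derivative:
  assumes "smooth_on S f" "open S"
  shows "smooth_on S (\<lambda>x. frechet_derivative f (at x) w)"
proof (rule smooth_on_cong[OF assms(2)])
  have "smooth_on S (\<lambda>x. frechet_derivative f (at x) i)" if "i \<in> Basis" for i
    using Ck_on_SucD(2)[OF assms(2) smooth_onD[OF assms(1)] that] by (simp add: smooth_on_def)
  then show "smooth_on S (\<lambda>x. \<Sum>i\<in>Basis. (w \<bullet> i) *\<^sub>R frechet_derivative f (at x) i)"
    by (intro smooth_on_sum smooth_on_scaleR smooth_on_const assms(2))
  fix x assume "x \<in> S"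
  then have "linear (frechet_derivative f (at x))"
    using assms smooth_on_has_derivative has_derivative_linear by blast
  then have "frechet_derivative f (at x) (\<Sum>i\<in>Basis. (w \<bullet> i) *\<^sub>R i)
      = (\<Sum>i\<in>Basis. (w \<bullet> i) *\<^sub>R frechet_derivative f (at x) i)"
    by (simp add: linear_sum linear_scale)
  then show "(\<Sum>i\<in>Basis. (w \<bullet> i) *\<^sub>R frechet_derivative f (at x) i) = frechet_derivative f (at x) w"
    by (simp only: euclidean_representation)
qed

lemma smooth_on_continuous: "smooth_on S f \<Longrightarrow> open S \<Longrightarrow> continuous_on S f"
  using Ck_on_continuous smooth_onD by blast

section \<open>Curves, growth estimates and injectivity of derivatives\<close>

lemma difference_quotient_tendsto:
  assumes "(f has_vector_derivative f') (at t)"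
  shows "((\<lambda>s. (f s - f t) /\<^sub>R (s - t)) \<longlongrightarrow> f') (at t)"
proof (rule LIM_zero_cancel, rule tendsto_norm_zero_cancel)
  have "((\<lambda>s. norm ((f s - f t) - (s - t) *\<^sub>R f') / norm (s - t)) \<longlongrightarrow> 0) (at t)"
    using assms by (simp add: has_vector_derivative_def has_derivative_iff_norm)
  moreover have "norm ((f s - f t) - (s - t) *\<^sub>R f') / norm (s - t) = norm ((f s - f t) /\<^sub>R (s - t) - f')"
    if "s \<noteq> t" for s
  proof -
    have "(f s - f t) /\<^sub>R (s - t) - f' = ((f s - f t) - (s - t) *\<^sub>R f') /\<^sub>R (s - t)"
      using that by (simp add: scaleR_diff_right)
    then show ?thesis by (simp add: divide_inverse mult.commute)
  qed
  then have "\<forall>\<^sub>F s in at t. norm ((f s - f t) - (s - t) *\<^sub>R f') / norm (s - t)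
      = norm ((f s - f t) /\<^sub>R (s - t) - f')"
    by (simp add: eventually_at_filter)
  ultimately show "((\<lambda>s. norm ((f s - f t) /\<^sub>R (s - t) - f')) \<longlongrightarrow> 0) (at t)"
    using tendsto_cong by force
qed

lemma smooth_on_chain_curve:
  assumes "smooth_on T f" "open T" "(c has_vector_derivative c') (at t)" "c t \<in> T"
  shows "((\<lambda>t. f (c t)) has_vector_derivative frechet_derivative f (at (c t)) c') (at t)"
proof -
  have der: "(f has_derivative frechet_derivative f (at (c t))) (at (c t))"
    by (rule smooth_on_has_derivative[OF assms(1,2,4)])
  then have "linear (frechet_derivative f (at (c t)))" by (rule has_derivative_linear)
  with has_derivative_compose[OF assms(3)[unfolded has_vector_derivative_def] der] show ?thesis
    by (simp add: has_vector_derivative_def linear_scale)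
qed

lemma smooth_on_time_derivative:
  assumes "smooth_on T f" "open T" "(t, p) \<in> T"
  shows "((\<lambda>t. f (t, p)) has_vector_derivative frechet_derivative f (at (t, p)) (1, 0)) (at t)"
  by (rule smooth_on_chain_curve[OF assms(1,2), where c = "\<lambda>t. (t, p)"])
     (auto intro!: has_vector_derivative_Pair has_vector_derivative_id simp: assms(3))

text \<open>This carries identities known for \<alpha> \<noteq> \<beta> over to the
  diagonal.\<close>

lemma continuous_eq_at_puncture:
  fixes u v :: "real \<Rightarrow> 'b::real_normed_vector"
  assumes "continuous_on UNIV u" "continuous_on UNIV v" "\<And>s. s \<noteq> t \<Longrightarrow> u s = v s"
  shows "u t = v t"
proof -
  have "u \<midarrow>t\<rightarrow> u t" "v \<midarrow>t\<rightarrow> v t"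
    using assms(1,2) by (simp_all add: continuous_on_def)
  moreover have "\<forall>\<^sub>F s in at t. u s = v s"
    using assms(3) by (simp add: eventually_at_filter)
  ultimately have "v \<midarrow>t\<rightarrow> u t" using tendsto_cong by force
  then show ?thesis using \<open>v \<midarrow>t\<rightarrow> v t\<close> tendsto_unique[OF at_neq_bot] by blast
qed

text \<open>The squared norm damped by \<open>exp (- 2 * K * (t - \<alpha>))\<close> has nonpositive
  derivative, by the Cauchy-Schwarz inequality and the bound on \<open>z'\<close>. Squaring keeps
  the function differentiable at zeros of \<open>z\<close>.\<close>

lemma gronwall_norm:
  fixes z :: "real \<Rightarrow> 'a::real_inner"
  assumes "\<alpha> \<le> \<beta>"
    and z: "\<And>t. t \<in> {\<alpha>..\<beta>} \<Longrightarrow> (z has_vector_derivative z' t) (at t)"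
    and bound: "\<And>t. t \<in> {\<alpha>..\<beta>} \<Longrightarrow> norm (z' t) \<le> K * norm (z t)"
  shows "norm (z \<beta>) \<le> exp (K * (\<beta> - \<alpha>)) * norm (z \<alpha>)"
proof -
  define u where "u t = (z t \<bullet> z t) * exp (- 2 * K * (t - \<alpha>))" for t
  have "u \<beta> \<le> u \<alpha>"
  proof (rule DERIV_nonpos_imp_nonincreasing[OF \<open>\<alpha> \<le> \<beta>\<close>])
    fix t assume "\<alpha> \<le> t" "t \<le> \<beta>"
    then have t: "t \<in> {\<alpha>..\<beta>}" by simp
    have "((\<lambda>t. z t \<bullet> z t) has_derivative (\<lambda>h. z t \<bullet> (h *\<^sub>R z' t) + (h *\<^sub>R z' t) \<bullet> z t)) (at t)"
      using z[OF t] by (intro has_derivative_inner) (simp_all add: has_vector_derivative_def)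
    then have zz: "((\<lambda>t. z t \<bullet> z t) has_real_derivative 2 * (z t \<bullet> z' t)) (at t)"
      by (rule has_derivative_imp_has_field_derivative) (simp add: inner_commute algebra_simps)
    have "(u has_real_derivative (2 * (z t \<bullet> z' t) - 2 * K * (z t \<bullet> z t)) * exp (- 2 * K * (t - \<alpha>))) (at t)"
      unfolding u_def[abs_def] by (rule derivative_eq_intros zz refl | simp add: algebra_simps)+
    moreover have "z t \<bullet> z' t \<le> K * (z t \<bullet> z t)"
    proof -
      have "z t \<bullet> z' t \<le> norm (z t) * norm (z' t)" by (rule norm_cauchy_schwarz)
      also have "\<dots> \<le> norm (z t) * (K * norm (z t))" by (intro mult_left_mono bound t) simp
      finally show ?thesis by (simp add: dot_square_norm power2_eq_square algebra_simps)
    qed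
    ultimately show "\<exists>y. (u has_real_derivative y) (at t) \<and> y \<le> 0"
      by (intro exI[of _ "(2 * (z t \<bullet> z' t) - 2 * K * (z t \<bullet> z t)) * exp (- 2 * K * (t - \<alpha>))"])
         (simp add: mult_le_0_iff)
  qed
  then have "(norm (z \<beta>))\<^sup>2 * exp (- 2 * K * (\<beta> - \<alpha>)) \<le> (norm (z \<alpha>))\<^sup>2"
    by (simp add: u_def dot_square_norm)
  moreover have "exp (- 2 * K * (\<beta> - \<alpha>)) = inverse ((exp (K * (\<beta> - \<alpha>)))\<^sup>2)"
    by (simp add: power2_eq_square exp_minus[symmetric] exp_add[symmetric] algebra_simps)
  moreover have "x \<le> (e * y)\<^sup>2" if "x * inverse (e\<^sup>2) \<le> y\<^sup>2" "e > 0" for x y e :: real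
    using that by (simp add: field_simps)
  ultimately have "(norm (z \<beta>))\<^sup>2 \<le> (exp (K * (\<beta> - \<alpha>)) * norm (z \<alpha>))\<^sup>2"
    by simp
  then show ?thesis by (rule power2_le_imp_le) simp
qed

lemma smooth_on_lipschitz:
  assumes "smooth_on UNIV f" "compact K" "convex K"
  obtains L where "L \<ge> 0" "\<And>x y. x \<in> K \<Longrightarrow> y \<in> K \<Longrightarrow> norm (f x - f y) \<le> L * norm (x - y)"
proof -
  let ?D = "\<lambda>x. frechet_derivative f (at x)"
  have der: "(f has_derivative ?D x) (at x)" for x
    by (rule smooth_on_has_derivative[OF assms(1)]) auto
  \<comment> \<open>This sum dominates the operator norm of the derivative and is visibly continuous
    in \<open>x\<close>, hence bounded on the compact set. The mean value inequality on the convex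
    set then gives the Lipschitz bound.\<close>
  define b where "b x = (\<Sum>i\<in>Basis. norm (?D x i))" for x
  have "continuous_on K b"
    unfolding b_def
    by (intro continuous_intros continuous_on_subset[OF smooth_on_continuous[OF smooth_on_frechet_derivative[OF assms(1)]]]) auto
  then have "bounded (b ` K)" using assms(2) compact_continuous_image compact_imp_bounded by blast
  then obtain L where "L > 0" and L: "\<And>x. x \<in> K \<Longrightarrow> norm (b x) \<le> L"
    unfolding bounded_pos by blast
  have "onorm (?D x) \<le> L" if "x \<in> K" for x
  proof (rule onorm_bound)
    fix w
    have lin: "linear (?D x)" using der has_derivative_linear by blast
    have "norm (?D x w) = norm (\<Sum>i\<in>Basis. (w \<bullet> i) *\<^sub>R ?D x i)"
      by (subst euclidean_representation[of w, symmetric], subst linear_sum[OF lin])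
         (simp only: linear_scale[OF lin])
    also have "\<dots> \<le> (\<Sum>i\<in>Basis. norm w * norm (?D x i))"
      by (rule sum_norm_le) (simp add: Basis_le_norm mult_right_mono)
    also have "\<dots> = b x * norm w" by (simp add: b_def sum_distrib_left mult.commute)
    also have "\<dots> \<le> L * norm w" using L[OF that] by (intro mult_right_mono) auto
    finally show "norm (?D x w) \<le> L * norm w" .
  qed (use \<open>L > 0\<close> in simp)
  then have "norm (f x - f y) \<le> L * norm (x - y)" if "x \<in> K" "y \<in> K" for x y
    using differentiable_bound[OF assms(3) has_derivative_at_withinI[OF der] _ that, of L] by blast
  then show ?thesis using that \<open>L > 0\<close> by (meson less_imp_le)
qed

text \<open>Apply the expansion estimate to \<open>w + t *\<^sub>R k\<close> and divide by the
  absolute value of \<open>t\<close>. The norm of \<open>k\<close> is then at most \<open>C\<close>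
  times the norm of a difference quotient, which tends to 0 when the derivative kills
  \<open>k\<close>.\<close>

lemma frechet_derivative_injective_if_expanding:
  fixes g :: "'p::euclidean_space \<times> 'a::euclidean_space \<Rightarrow> 'b::real_normed_vector"
  assumes g: "smooth_on UNIV g"
    and expand: "\<And>w'. norm (w' - w) \<le> 1 \<Longrightarrow> norm (w' - w) \<le> C * norm (g (p, w') - g (p, w))"
    and zero: "frechet_derivative g (at (p, w)) (0, k) = 0"
  shows "k = 0"
proof -
  have "((\<lambda>t. (p, w + t *\<^sub>R k)) has_vector_derivative (0, k)) (at 0)"
    by (auto intro!: has_vector_derivative_Pair derivative_eq_intros simp: has_vector_derivative_def)
  from smooth_on_chain_curve[OF g _ this]
  have "((\<lambda>t. g (p, w + t *\<^sub>R k)) has_vector_derivative 0) (at 0)" by (simp add: zero)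
  from tendsto_mult[OF tendsto_const[of C] tendsto_norm[OF difference_quotient_tendsto[OF this]]]
  have lim: "((\<lambda>t. C * norm ((g (p, w + t *\<^sub>R k) - g (p, w)) /\<^sub>R t)) \<longlongrightarrow> 0) (at 0)"
    by simp
  have "((\<lambda>t. norm (t *\<^sub>R k)) \<longlongrightarrow> norm (0 *\<^sub>R k)) (at 0)" by (intro tendsto_intros)
  then have "\<forall>\<^sub>F t in at 0. norm (t *\<^sub>R k) < 1" by (rule order_tendstoD(2)) simp
  moreover have "\<forall>\<^sub>F t in at 0. (t::real) \<noteq> 0" by (simp add: eventually_at_filter)
  ultimately have "\<forall>\<^sub>F t in at 0. norm k \<le> C * norm ((g (p, w + t *\<^sub>R k) - g (p, w)) /\<^sub>R t)"
  proof eventually_elim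
    case (elim t)
    then have "\<bar>t\<bar> * norm k \<le> C * norm (g (p, w + t *\<^sub>R k) - g (p, w))"
      using expand[of "w + t *\<^sub>R k"] by simp
    then have "norm k \<le> C * norm (g (p, w + t *\<^sub>R k) - g (p, w)) / \<bar>t\<bar>"
      using elim by (simp add: field_simps)
    then show ?case by (simp add: divide_inverse mult.commute mult.left_commute)
  qed
  from tendsto_lowerbound[OF lim this at_neq_bot] show ?thesis by simp
qed

section \<open>Parametric integrals and inverses\<close>

text \<open>Differentiation under the integral sign yields an integral of the same kind, with
  \<open>h\<close> replaced by its smooth derivative in the direction \<open>(i, 0)\<close>; hence
  the induction over all \<open>h\<close> at once.\<close>

lemma smooth_on_parametric_integral:
  fixes h :: "'p::euclidean_space \<times> real \<Rightarrow> 'b::banach"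
  assumes "smooth_on UNIV h"
  shows "smooth_on UNIV (\<lambda>p. integral {0..1} (\<lambda>s. h (p, s)))"
proof -
  have "Ck_on k UNIV (\<lambda>p. integral {0..1} (\<lambda>s. h (p, s)))" for k
    using assms
  proof (induction k arbitrary: h)
    case 0
    have "continuous_on UNIV h" by (rule smooth_on_continuous[OF 0]) simp
    then have "continuous_on (UNIV \<times> cbox 0 1) (\<lambda>(p, s). h (p, s))"
      by (auto intro: continuous_on_subset)
    from integral_continuous_on_param[OF this] show ?case by simp
  next
    case (Suc k)
    define D where "D z w = frechet_derivative h (at z) w" for z w
    have der: "(h has_derivative D z) (at z)" for z
      unfolding D_def by (rule smooth_on_has_derivative[OF Suc.prems]) auto
    have smooth: "smooth_on UNIV (\<lambda>z. D z w)" for w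
      unfolding D_def by (rule smooth_on_frechet_derivative[OF Suc.prems]) auto
    have bl: "bounded_linear (\<lambda>w. D z (w, 0))" for z
      using has_derivative_bounded_linear[OF der, of z]
      by (rule bounded_linear_compose) (intro bounded_linear_Pair bounded_linear_ident bounded_linear_zero)
    \<comment> \<open>The Leibniz rule asks for the derivative as a continuous map into the bounded
      linear functions. Its continuity can be tested on basis vectors, where smoothness of
      \<open>D\<close> applies.\<close>
    define E where "E p s = Blinfun (\<lambda>w. D (p, s) (w, 0))" for p s
    have E: "blinfun_apply (E p s) w = D (p, s) (w, 0)" for p s w
      unfolding E_def by (simp add: bounded_linear_Blinfun_apply[OF bl])
    have contE: "continuous_on (UNIV \<times> cbox 0 1) (\<lambda>(p, s). E p s)"
    proof (rule continuous_on_blinfun_componentwise)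
      fix i :: 'p assume "i \<in> Basis"
      have "continuous_on UNIV (\<lambda>z. D z (i, 0))"
        by (rule smooth_on_continuous[OF smooth]) simp
      then show "continuous_on (UNIV \<times> cbox 0 1) (\<lambda>x. blinfun_apply (case x of (p, s) \<Rightarrow> E p s) i)"
        by (auto simp: E case_prod_unfold intro: continuous_on_subset)
    qed
    have conth: "continuous_on UNIV h"
      by (rule smooth_on_continuous[OF Suc.prems]) simp
    have int: "(\<lambda>s. h (p, s)) integrable_on cbox 0 1" for p
      by (intro integrable_continuous continuous_on_compose2[OF conth] continuous_intros) auto
    have derh: "((\<lambda>p. h (p, s)) has_derivative blinfun_apply (E p s)) (at p)" for p s
    proof -
      have "((\<lambda>p. (p, s)) has_derivative (\<lambda>w. (w, 0))) (at p)"
        by (intro derivative_eq_intros) auto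
      from has_derivative_compose[OF this der] show ?thesis
        by (simp add: E[abs_def] fun_eq_iff)
    qed
    have contEp: "continuous_on (cbox 0 1) (\<lambda>s. E p s)" for p
      using continuous_on_compose2[OF contE, of "cbox 0 1" "\<lambda>s. (p, s)"]
      by (force intro: continuous_intros)
    show ?case
    proof (rule Ck_on_SucI)
      fix p
      show "((\<lambda>p. integral {0..1} (\<lambda>s. h (p, s))) has_derivative
          (\<lambda>w. integral {0..1} (\<lambda>s. D (p, s) (w, 0)))) (at p)"
      proof -
        have "blinfun_apply (integral (cbox 0 1) (E p)) = (\<lambda>w. integral {0..1} (\<lambda>s. D (p, s) (w, 0)))"
          by (rule ext, subst blinfun_apply_integral[OF integrable_continuous[OF contEp]])
             (simp add: E)
        then show ?thesis
          using leibniz_rule[OF derh int contE, of p] by simp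
      qed
    next
      fix i :: 'p
      show "Ck_on k UNIV (\<lambda>p. integral {0..1} (\<lambda>s. D (p, s) (i, 0)))"
        by (rule Suc.IH[OF smooth])
    qed simp
  qed
  then show ?thesis by (simp add: smooth_on_def)
qed

section \<open>Cramer's rule and smoothness of parametrized inverses\<close>

definition cramer_solution :: "real^'n^'n \<Rightarrow> real^'n \<Rightarrow> real^'n" where
  "cramer_solution A b = (\<chi> k. det (\<chi> i j. if j = k then b $ i else A $ i $ j) * inverse (det A))"

lemma cramer_solution_unique: "det A \<noteq> 0 \<Longrightarrow> A *v x = b \<Longrightarrow> x = cramer_solution A b"
  unfolding cramer_solution_def using cramer[of A x b] by (simp add: divide_inverse)

text \<open>The formula consists of determinants, which are polynomials in the entries, times the
  inverse of a nonvanishing determinant. It makes the solution of a linear system as regular as its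
  data.\<close>

lemma Ck_on_cramer_solution:
  assumes "open S" "\<And>i j. Ck_on k S (\<lambda>x. A x $ i $ j)" "\<And>i. Ck_on k S (\<lambda>x. b x $ i)"
    "\<And>x. x \<in> S \<Longrightarrow> det (A x) \<noteq> 0"
  shows "Ck_on k S (\<lambda>x. cramer_solution (A x) (b x))"
proof -
  have "Ck_on k S (\<lambda>x. if j = l then b x $ i else A x $ i $ j)" for i j l
    using assms by (cases "j = l") auto
  then have "Ck_on k S (\<lambda>x. det (\<chi> i j. if j = l then b x $ i else A x $ i $ j))" for l
    by (intro Ck_on_det[OF assms(1)]) (simp only: vec_lambda_beta)
  then show ?thesis
    unfolding cramer_solution_def
    by (intro Ck_on_vec_lambda bounded_bilinear.Ck_on[OF bounded_bilinear_mult] Ck_on_inverse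
        Ck_on_det[of S k A] assms)
qed

text \<open>A global inverse function theorem with parameters: bijectivity is assumed, so only
  regularity of \<open>B\<close> is at stake. Adjoining the parameter turns \<open>g\<close> into a
  bijection \<open>T\<close> of the whole space with inverse \<open>U\<close>. Continuity of
  \<open>U\<close> comes first, then its derivative, then all orders by bootstrapping.\<close>

proposition smooth_on_parametric_inverse:
  fixes g :: "'p::euclidean_space \<times> (real^'n) \<Rightarrow> real^'n" and B :: "'p \<times> (real^'n) \<Rightarrow> real^'n"
  assumes g: "smooth_on UNIV g"
    and gB: "\<And>p v. g (p, B (p, v)) = v"
    and Bg: "\<And>p w. B (p, g (p, w)) = w"
    and inj: "\<And>p w k. frechet_derivative g (at (p, w)) (0, k) = 0 \<Longrightarrow> k = 0"
  shows "smooth_on UNIV B"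
proof -
  define D where "D z w = frechet_derivative g (at z) w" for z w
  have der: "(g has_derivative D z) (at z)" for z
    unfolding D_def by (rule smooth_on_has_derivative[OF g]) auto
  have linD: "linear (D z)" for z using der has_derivative_linear by blast
  have smooth: "smooth_on UNIV (\<lambda>z. D z w)" for w
    unfolding D_def by (rule smooth_on_frechet_derivative[OF g]) auto
  define A where "A z = matrix (\<lambda>k. D z (0, k))" for z
  have lin2: "linear (\<lambda>k. D z (0, k))" for z
    using linear_compose[OF _ linD[of z], of "\<lambda>k. (0, k)"] 
    by (simp add: o_def linear_iff)
  have A: "A z *v k = D z (0, k)" for z k
    unfolding A_def using matrix_works[of "\<lambda>k. D z (0, k)"] lin2[of z]
    by (simp add: linear_matrix_vector_mul_eq)
  have injA: "inj ((*v) (A z))" for z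
    by (rule linear_injective_0[THEN iffD2]) (use inj[of "fst z" "snd z"] in \<open>auto simp: A D_def[symmetric]\<close>)
  have det: "det (A z) \<noteq> 0" for z
    using injA invertible_det_nz invertible_left_inverse matrix_left_invertible_injective by metis
  have A_entry: "A z $ i $ j = D z (0, axis j 1) $ i" for z i j
    by (simp add: A_def matrix_def)
  define T where "T = (\<lambda>z. (fst z, g z))"
  define U where "U = (\<lambda>q. (fst q, B q))"
  have contg: "continuous_on UNIV g" by (rule smooth_on_continuous[OF g]) simp
  have UT: "U (T z) = z" and TU: "T (U z) = z" for z
    by (cases z; simp add: U_def T_def gB Bg)+
  \<comment> \<open>Invariance of domain: a continuous injection between spaces of equal dimension
    has a continuous inverse on its image.\<close>
  have "continuous_on (T ` UNIV) U"
    by (rule continuous_on_inverse_open) 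
       (use UT contg in \<open>auto simp: T_def intro!: continuous_intros\<close>)
  moreover have "T ` UNIV = UNIV" by (metis TU surjI)
  ultimately have contU: "continuous_on UNIV U" by simp
  \<comment> \<open>The candidate derivative of \<open>B\<close> at \<open>q\<close>, obtained by
    differentiating \<open>g (p, B (p, v)) = v\<close>: the vector \<open>C q w\<close> is the
    solution \<open>y\<close> of \<open>D (U q) (fst w, y) = snd w\<close>.\<close>
  define C where "C q w = cramer_solution (A (U q)) (snd w - D (U q) (fst w, 0))" for q w
  have ADC: "D (U q) (fst w, C q w) = snd w" for q w
  proof -
    have "surj ((*v) (A (U q)))"
      using injA linear_injective_imp_surjective matrix_vector_mul_linear by blast
    then obtain x where x: "A (U q) *v x = snd w - D (U q) (fst w, 0)" by (metis surjD)
    then have "x = C q w" unfolding C_def using cramer_solution_unique det by blast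
    then have "D (U q) (0, C q w) = snd w - D (U q) (fst w, 0)" using x A by metis
    then show ?thesis using linear_add[OF linD, of "U q" "(fst w, 0)" "(0, C q w)"] by simp
  qed
  have uniq: "C q w = y" if "D (U q) (fst w, y) = snd w" for q w y
  proof -
    have "A (U q) *v y = snd w - D (U q) (fst w, 0)"
      using linear_add[OF linD, of "U q" "(fst w, 0)" "(0, y)"] that by (simp add: A)
    then show ?thesis unfolding C_def using cramer_solution_unique det by metis
  qed
  have linC: "linear (C q)" for q
  proof (rule linearI)
    fix w w' and c :: real
    show "C q (w + w') = C q w + C q w'"
      by (rule uniq) (use linear_add[OF linD, of "U q" "(fst w, C q w)" "(fst w', C q w')"] in \<open>simp add: ADC\<close>)
    show "C q (c *\<^sub>R w) = c *\<^sub>R C q w"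
      by (rule uniq) (use linear_scale[OF linD, of "U q" c "(fst w, C q w)"] in \<open>simp add: ADC\<close>)
  qed
  have derB: "(B has_derivative C q) (at q)" for q
  proof -
    have "(U has_derivative (\<lambda>w. (fst w, C q w))) (at q)"
    proof (rule has_derivative_inverse_basic[where T = UNIV])
      show "(T has_derivative (\<lambda>w. (fst w, D (U q) w))) (at (U q))"
        unfolding T_def by (intro has_derivative_Pair der has_derivative_fst has_derivative_ident)
      show "bounded_linear (\<lambda>w. (fst w, C q w))"
        by (intro bounded_linear_Pair bounded_linear_fst linear_conv_bounded_linear[THEN iffD1] linC)
      show "(\<lambda>w. (fst w, C q w)) \<circ> (\<lambda>w. (fst w, D (U q) w)) = id"
        by (rule ext) (auto intro: uniq)
      show "continuous (at q) U" using contU continuous_on_eq_continuous_at[of UNIV U] by blast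
    qed (use TU in auto)
    from has_derivative_snd[OF this] show ?thesis by (simp add: U_def)
  qed
  have "Ck_on k UNIV B" for k
  proof (induction k)
    case 0
    then show ?case using continuous_on_snd[OF contU] by (simp add: U_def)
  next
    case (Suc k)
    \<comment> \<open>Bootstrapping: the derivative \<open>C\<close> is built from smooth maps
      evaluated at \<open>U\<close>, so order \<open>k\<close> of \<open>B\<close> gives order
      \<open>k\<close> of its derivative, hence order \<open>Suc k\<close> of
      \<open>B\<close>.\<close>
    have "Ck_on k UNIV U"
      unfolding U_def by (intro Ck_on_Pair Suc Ck_on_bounded_linear[OF _ bounded_linear_fst] Ck_on_id) auto
    then have DU: "Ck_on k UNIV (\<lambda>q. D (U q) w)" for w
      using Ck_on_compose[OF _ _ _ _ smooth_onD[OF smooth], of UNIV U k w] by simp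
    have *: "Ck_on k UNIV (\<lambda>q. D (U q) w $ i)" for w i
      by (intro Ck_on_bounded_linear[OF _ bounded_linear_vec_nth DU]) auto
    have "Ck_on k UNIV (\<lambda>q. c + - 1 * D (U q) w $ i)" for w i c
      by (intro Ck_on_add Ck_on_const * bounded_bilinear.Ck_on[OF bounded_bilinear_mult]) auto
    then have **: "Ck_on k UNIV (\<lambda>q. c - D (U q) w $ i)" for w i c by simp
    show ?case
      by (rule Ck_on_SucI[OF _ derB])
         (auto simp: C_def A_entry det intro!: Ck_on_cramer_solution * **)
  qed
  then show ?thesis by (simp add: smooth_on_def)
qed

section \<open>From the extension to the equation\<close>

locale neumann_extension =
  fixes F :: "real \<Rightarrow> real \<Rightarrow> real \<Rightarrow> real^'n \<Rightarrow> real^'n \<Rightarrow> real^'n"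
    and S :: "real \<times> real \<times> real \<times> (real^'n) \<times> (real^'n) \<Rightarrow> real^'n"
  assumes consistent: "\<alpha> \<noteq> \<beta> \<Longrightarrow> \<gamma> \<noteq> \<delta> \<Longrightarrow>
      F \<tau> \<alpha> \<beta> a b = F \<tau> \<gamma> \<delta> (F \<gamma> \<alpha> \<beta> a b) (F \<delta> \<alpha> \<beta> a b)"
    and left: "\<alpha> \<noteq> \<beta> \<Longrightarrow> F \<alpha> \<alpha> \<beta> a b = a"
    and right: "\<alpha> \<noteq> \<beta> \<Longrightarrow> F \<beta> \<alpha> \<beta> a b = b"
    and smooth: "smooth_on UNIV S"
    and ext: "\<alpha> \<noteq> \<beta> \<Longrightarrow> S (\<tau>, \<alpha>, \<beta>, a, v) = F \<tau> \<alpha> \<beta> a (a + (\<beta> - \<alpha>) *\<^sub>R v)"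
begin

section \<open>The second-order equation read off from \<open>S\<close>\<close>

definition "S1 z = frechet_derivative S (at z) (1, 0)"
definition "S2 z = frechet_derivative S1 (at z) (1, 0)"
definition "rhs = (\<lambda>(t, x, v). S2 (t, t, t, x, v))"

lemma smooth_S1: "smooth_on UNIV S1"
  unfolding S1_def[abs_def] by (rule smooth_on_frechet_derivative[OF smooth]) simp

lemma smooth_S2: "smooth_on UNIV S2"
  unfolding S2_def[abs_def] by (rule smooth_on_frechet_derivative[OF smooth_S1]) simp

lemma smooth_rhs: "smooth_on UNIV rhs"
  unfolding rhs_def case_prod_unfold
  by (rule smooth_on_compose[OF smooth_S2]) (auto intro!: smooth_intros)

lemma continuous_S [continuous_intros]:
  "continuous_on A c \<Longrightarrow> continuous_on A (\<lambda>t. S (c t))"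
  by (rule continuous_on_compose2[OF smooth_on_continuous[OF smooth]]) auto

lemma continuous_S1 [continuous_intros]:
  "continuous_on A c \<Longrightarrow> continuous_on A (\<lambda>t. S1 (c t))"
  by (rule continuous_on_compose2[OF smooth_on_continuous[OF smooth_S1]]) auto

lemma S_deriv: "((\<lambda>t. S (t, p)) has_vector_derivative S1 (t, p)) (at t)"
  unfolding S1_def by (rule smooth_on_time_derivative[OF smooth]) auto

lemma S1_deriv: "((\<lambda>t. S1 (t, p)) has_vector_derivative S2 (t, p)) (at t)"
  unfolding S2_def by (rule smooth_on_time_derivative[OF smooth_S1]) auto

lemma F_eq_S: "\<alpha> \<noteq> \<beta> \<Longrightarrow> F \<tau> \<alpha> \<beta> a b = S (\<tau>, \<alpha>, \<beta>, a, (b - a) /\<^sub>R (\<beta> - \<alpha>))"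
  by (simp add: ext)

text \<open>For \<gamma> \<noteq> \<delta> this is condition (i). Since \<alpha> and \<beta> stay
  apart, both sides are continuous in \<delta>, and the case \<gamma> = \<delta> follows in the
  limit.\<close>

lemma S_consistent:
  assumes "\<alpha> \<noteq> \<beta>"
  shows "F \<tau> \<alpha> \<beta> (S (\<alpha>, \<gamma>, \<delta>, a, v)) (S (\<beta>, \<gamma>, \<delta>, a, v)) = S (\<tau>, \<gamma>, \<delta>, a, v)"
    (is "?l \<delta> = ?r \<delta>")
proof (cases "\<gamma> = \<delta>")
  case False
  then show ?thesis unfolding ext[OF False] using consistent[OF False assms] by metis
next
  case True
  have "?l \<gamma> = ?r \<gamma>"
  proof (rule continuous_eq_at_puncture[of ?l ?r])
    show "continuous_on UNIV ?l" unfolding F_eq_S[OF assms] by (intro continuous_intros)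
    show "continuous_on UNIV ?r" by (intro continuous_intros)
    show "?l \<delta> = ?r \<delta>" if "\<delta> \<noteq> \<gamma>" for \<delta>
      unfolding ext[OF that[symmetric]] using consistent[OF that[symmetric] assms] by metis
  qed
  then show ?thesis using True by simp
qed

text \<open>The data of the curve at the times \<open>s\<close> and \<open>r\<close> enter
  \<open>S\<close> as a value and a mean velocity. As \<open>r\<close> tends to \<open>s\<close> the
  mean velocity tends to the derivative, and continuity of \<open>S\<close> on the diagonal carries
  the identity to the limit.\<close>

lemma S_initial:
  "S (\<tau>, \<gamma>, \<delta>, a, v) = S (\<tau>, s, s, S (s, \<gamma>, \<delta>, a, v), S1 (s, \<gamma>, \<delta>, a, v))"
proof -
  let ?z = "\<lambda>t. S (t, \<gamma>, \<delta>, a, v)"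
  have cont: "continuous_on UNIV S" by (intro continuous_intros)
  have "((\<lambda>r. (?z r - ?z s) /\<^sub>R (r - s)) \<longlongrightarrow> S1 (s, \<gamma>, \<delta>, a, v)) (at s)"
    by (rule difference_quotient_tendsto[OF S_deriv])
  then have "((\<lambda>r. (\<tau>, s, r, ?z s, (?z r - ?z s) /\<^sub>R (r - s))) \<longlongrightarrow> (\<tau>, s, s, ?z s, S1 (s, \<gamma>, \<delta>, a, v))) (at s)"
    by (intro tendsto_intros)
  then have "((\<lambda>r. S (\<tau>, s, r, ?z s, (?z r - ?z s) /\<^sub>R (r - s))) \<longlongrightarrow> S (\<tau>, s, s, ?z s, S1 (s, \<gamma>, \<delta>, a, v))) (at s)"
    using continuous_on_tendsto_compose[OF cont] by fastforce
  moreover have "\<forall>\<^sub>F r in at s. S (\<tau>, s, r, ?z s, (?z r - ?z s) /\<^sub>R (r - s)) = ?z \<tau>"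
    using S_consistent[of s _ \<tau> \<gamma> \<delta> a v] F_eq_S[of s] by (auto simp: eventually_at_filter)
  ultimately have "((\<lambda>r. ?z \<tau>) \<longlongrightarrow> S (\<tau>, s, s, ?z s, S1 (s, \<gamma>, \<delta>, a, v))) (at s)"
    using tendsto_cong by force
  then show ?thesis using tendsto_unique[OF at_neq_bot _ tendsto_const] by metis
qed

text \<open>By \<open>S_initial\<close> the curve with parameter \<open>p\<close> is also the curve
  with the diagonal parameter \<open>q\<close> given by its own position and velocity at
  \<open>s\<close>. Equal curves have equal second derivatives, and for \<open>q\<close> this is the
  definition of \<open>rhs\<close>.\<close>

lemma S2_eq_rhs: "S2 (s, p) = rhs (s, S (s, p), S1 (s, p))"
proof -
  define q where "q = (s, s, S (s, p), S1 (s, p))"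
  have S: "(\<lambda>t. S (t, p)) = (\<lambda>t. S (t, q))"
    unfolding q_def by (cases p) (auto intro: S_initial)
  have S1: "(\<lambda>t. S1 (t, p)) = (\<lambda>t. S1 (t, q))"
    using S_deriv[of p] S_deriv[of q] vector_derivative_unique_at unfolding S by blast
  have "S2 (s, p) = S2 (s, q)"
    using S1_deriv[of p] S1_deriv[of q] vector_derivative_unique_at unfolding S1 by blast
  then show ?thesis by (simp add: rhs_def q_def)
qed

lemma complete_solution_S: "complete_solution rhs (\<lambda>t. S (t, p))"
  unfolding complete_solution_def using S_deriv S1_deriv S2_eq_rhs by metis

section \<open>Values and velocities of \<open>S\<close> on the diagonal\<close>

lemma S_diag: "S (\<gamma>, \<gamma>, \<delta>, a, v) = a"
proof (cases "\<gamma> = \<delta>")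
  case True
  have "S (\<gamma>, \<gamma>, \<gamma>, a, v) = a"
    by (rule continuous_eq_at_puncture[of "\<lambda>\<delta>. S (\<gamma>, \<gamma>, \<delta>, a, v)"])
       (auto intro!: continuous_intros simp: ext left)
  then show ?thesis using True by simp
qed (simp add: ext left)

lemma S_diag2: "S (\<delta>, \<gamma>, \<delta>, a, v) = a + (\<delta> - \<gamma>) *\<^sub>R v"
  by (cases "\<gamma> = \<delta>") (simp_all add: ext right S_diag)

text \<open>The time direction is the difference of the directions \<open>(1, 0, 1, 0, 0)\<close>
  and \<open>(0, 0, 1, 0, 0)\<close>. Along the first, \<open>S\<close> is the affine function of
  \<open>S_diag2\<close> with derivative \<open>v\<close>; along the second it is constant by
  \<open>S_diag\<close>.\<close>

lemma S1_diag: "S1 (\<gamma>, \<gamma>, \<gamma>, a, v) = v"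
proof -
  let ?D = "frechet_derivative S (at (\<gamma>, \<gamma>, \<gamma>, a, v))"
  have lin: "linear ?D"
    using smooth_on_has_derivative[OF smooth] has_derivative_linear by blast
  have "((\<lambda>\<delta>. S (\<delta>, \<gamma>, \<delta>, a, v)) has_vector_derivative ?D (1, 0, 1, 0, 0)) (at \<gamma>)"
    by (rule smooth_on_chain_curve[OF smooth])
       (auto intro!: has_vector_derivative_Pair has_vector_derivative_id)
  moreover have "((\<lambda>\<delta>. S (\<delta>, \<gamma>, \<delta>, a, v)) has_vector_derivative v) (at \<gamma>)"
    unfolding S_diag2 by (auto intro!: derivative_eq_intros simp: has_vector_derivative_def)
  ultimately have 1: "?D (1, 0, 1, 0, 0) = v" by (rule vector_derivative_unique_at)
  have "((\<lambda>\<delta>. S (\<gamma>, \<gamma>, \<delta>, a, v)) has_vector_derivative ?D (0, 0, 1, 0, 0)) (at \<gamma>)"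
    by (rule smooth_on_chain_curve[OF smooth])
       (auto intro!: has_vector_derivative_Pair has_vector_derivative_id)
  moreover have "((\<lambda>\<delta>. S (\<gamma>, \<gamma>, \<delta>, a, v)) has_vector_derivative 0) (at \<gamma>)"
    unfolding S_diag by simp
  ultimately have "?D (0, 0, 1, 0, 0) = 0" by (rule vector_derivative_unique_at)
  then show ?thesis
    using 1 linear_diff[OF lin, of "(1, 0, 1, 0, 0)" "(0, 0, 1, 0, 0)"]
    by (simp add: S1_def zero_prod_def)
qed

text \<open>Along a solution \<open>y\<close> the map \<open>s \<mapsto> S (\<tau>, s, s, y s, y' s)\<close> has at each \<open>s\<close> the same
  derivative as along the solution \<open>S (\<cdot>, s, s, y s, y' s)\<close> through the same data, where it is
  constant by \<open>S_initial\<close>; this yields uniqueness without a Gronwall estimate.\<close>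

lemma complete_solution_eq_S:
  assumes y: "\<And>t. (y has_vector_derivative y' t) (at t)"
    "\<And>t. (y' has_vector_derivative rhs (t, y t, y' t)) (at t)"
  shows "y \<tau> = S (\<tau>, s, s, y s, y' s)"
proof -
  define c where "c s = (\<tau>, s, s, y s, y' s)" for s
  have "((\<lambda>s. S (c s)) has_vector_derivative 0) (at s)" for s
  proof -
    define p where "p = (s, s, y s, y' s)"
    let ?D = "frechet_derivative S (at (c s))" 
    let ?c' = "(0, 1, 1, y' s, rhs (s, y s, y' s))"
    have *: "S (s, p) = y s" "S1 (s, p) = y' s" by (simp_all add: p_def S_diag S1_diag)
    have "((\<lambda>t. (\<tau>, t, t, S (t, p), S1 (t, p))) has_vector_derivative ?c') (at s)"
      using S_deriv[of p s] S1_deriv[of p s] S2_eq_rhs[of s p] *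
      by (auto intro!: has_vector_derivative_Pair has_vector_derivative_id)
    from smooth_on_chain_curve[OF smooth _ this] 
    have "((\<lambda>t. S (\<tau>, t, t, S (t, p), S1 (t, p))) has_vector_derivative ?D ?c') (at s)"
      by (simp add: * c_def)
    moreover have "(\<lambda>t. S (\<tau>, t, t, S (t, p), S1 (t, p))) = (\<lambda>t. S (\<tau>, p))"
      unfolding p_def by (rule HOL.ext) (rule S_initial[symmetric])
    ultimately have "?D ?c' = 0"
      using vector_derivative_unique_at[OF _ has_vector_derivative_const] by simp
    moreover have "((\<lambda>s. S (c s)) has_vector_derivative ?D ?c') (at s)"
      unfolding c_def by (rule smooth_on_chain_curve[OF smooth])
        (auto intro!: has_vector_derivative_Pair has_vector_derivative_id y)
    ultimately show ?thesis by simp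
  qed
  then have "S (c \<tau>) = S (c s)"
    using has_derivative_zero_unique[of UNIV "\<lambda>s. S (c s)" \<tau> s]
    by (simp add: has_vector_derivative_def)
  then show ?thesis by (simp add: c_def S_diag)
qed

section \<open>Solvability of the equation and smooth dependence\<close>

lemma dependence_rhs: "dependence F rhs"
  unfolding dependence_def complete_solution_def
proof clarify
  fix y y' and \<alpha> \<beta> \<tau> :: real
  assume y: "\<forall>t. (y has_vector_derivative y' t) (at t) \<and> (y' has_vector_derivative rhs (t, y t, y' t)) (at t)"
    and "\<alpha> \<noteq> \<beta>"
  \<comment> \<open>The base time 0 is an arbitrary choice: it exhibits \<open>y\<close> as a curve
    of \<open>S\<close>, so that \<open>S_consistent\<close> applies to it.\<close>
  have "y = (\<lambda>t. S (t, 0, 0, y 0, y' 0))"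
    using complete_solution_eq_S[of y y'] y by blast
  then show "F \<tau> \<alpha> \<beta> (y \<alpha>) (y \<beta>) = y \<tau>"
    using S_consistent[OF \<open>\<alpha> \<noteq> \<beta>\<close>] by metis
qed

lemma N_solvable_rhs: "N_solvable rhs"
  unfolding N_solvable_def
proof (intro allI impI)
  fix \<alpha> \<beta> :: real and a b :: "real^'n" assume "\<alpha> \<noteq> \<beta>"
  show "\<exists>!x. complete_solution rhs x \<and> x \<alpha> = a \<and> x \<beta> = b"
  proof (intro ex1I conjI)
    have "(\<lambda>\<tau>. F \<tau> \<alpha> \<beta> a b) = (\<lambda>\<tau>. S (\<tau>, \<alpha>, \<beta>, a, (b - a) /\<^sub>R (\<beta> - \<alpha>)))"
      using F_eq_S[OF \<open>\<alpha> \<noteq> \<beta>\<close>] by blast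
    then show "complete_solution rhs (\<lambda>\<tau>. F \<tau> \<alpha> \<beta> a b)"
      using complete_solution_S by metis
    show "x = (\<lambda>\<tau>. F \<tau> \<alpha> \<beta> a b)" if "complete_solution rhs x \<and> x \<alpha> = a \<and> x \<beta> = b" for x
      using that dependence_rhs \<open>\<alpha> \<noteq> \<beta>\<close> unfolding dependence_def by auto
  qed (use \<open>\<alpha> \<noteq> \<beta>\<close> in \<open>auto simp: left right\<close>)
qed

lemma smooth_dependence_rhs: "smooth_dependence F rhs"
proof -
  let ?O = "{(\<tau>, \<alpha>, \<beta>, a, b). \<alpha> \<noteq> \<beta>} :: (real \<times> real \<times> real \<times> (real^'n) \<times> (real^'n)) set"
  have "open ?O"
    unfolding case_prod_unfold by (intro open_Collect_neq continuous_intros)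
  \<comment> \<open>Off the diagonal \<open>F\<close> is recovered from \<open>S\<close> by the
    smooth substitution of the slope for \<open>b\<close>.\<close>
  have "smooth_on ?O (\<lambda>z. S (fst z, fst (snd z), fst (snd (snd z)), fst (snd (snd (snd z))),
      inverse (fst (snd (snd z)) - fst (snd z)) *\<^sub>R (snd (snd (snd (snd z))) - fst (snd (snd (snd z))))))"
    using \<open>open ?O\<close> by (intro smooth_on_compose[OF smooth] smooth_intros) auto
  then have "smooth_on ?O (\<lambda>(\<tau>, \<alpha>, \<beta>, a, b). F \<tau> \<alpha> \<beta> a b)"
    by (rule smooth_on_cong[OF \<open>open ?O\<close>, rotated]) (auto simp: F_eq_S)
  then show ?thesis
    unfolding smooth_dependence_def using dependence_rhs by blast
qed

end

section \<open>From the equation to the extension\<close>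

locale neumann_equation =
  fixes f :: "real \<times> (real^'n) \<times> (real^'n) \<Rightarrow> real^'n"
    and F :: "real \<Rightarrow> real \<Rightarrow> real \<Rightarrow> real^'n \<Rightarrow> real^'n \<Rightarrow> real^'n"
  assumes smooth_f: "smooth_on UNIV f"
    and solvable: "N_solvable f"
    and dependent: "smooth_dependence F f"
begin

text \<open>The velocity is an explicit argument because the initial velocity is the main object
  below, while \<open>complete_solution\<close> hides it behind an existential quantifier.\<close>

definition sol :: "(real \<Rightarrow> real^'n) \<Rightarrow> (real \<Rightarrow> real^'n) \<Rightarrow> bool" where
  "sol x x' \<longleftrightarrow> (\<forall>t. (x has_vector_derivative x' t) (at t) \<and>
      (x' has_vector_derivative f (t, x t, x' t)) (at t))"

lemma complete_solution_iff: "complete_solution f x \<longleftrightarrow> (\<exists>x'. sol x x')"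
  by (simp add: complete_solution_def sol_def)

definition "off_diagonal = ({(\<tau>, \<alpha>, \<beta>, a, b). \<alpha> \<noteq> \<beta>} :: (real \<times> real \<times> real \<times> (real^'n) \<times> (real^'n)) set)"
text \<open>Uncurried so that \<open>frechet_derivative\<close> applies; the direction
  \<open>(1, 0)\<close> in \<open>F1\<close> is then time.\<close>

definition "Fu = (\<lambda>(\<tau>, \<alpha>, \<beta>, a, b). F \<tau> \<alpha> \<beta> a b)"
definition "F1 z = frechet_derivative Fu (at z) (1, 0)"

lemma open_off_diagonal: "open off_diagonal"
  unfolding off_diagonal_def case_prod_unfold by (intro open_Collect_neq continuous_intros)

lemma in_off_diagonal [simp]: "(\<tau>, \<alpha>, \<beta>, a, b) \<in> off_diagonal \<longleftrightarrow> \<alpha> \<noteq> \<beta>"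
  by (simp add: off_diagonal_def)

lemma smooth_Fu: "smooth_on off_diagonal Fu"
  using dependent by (simp add: smooth_dependence_def off_diagonal_def Fu_def)

lemma smooth_F1: "smooth_on off_diagonal F1"
  unfolding F1_def[abs_def] by (rule smooth_on_frechet_derivative[OF smooth_Fu open_off_diagonal])

lemma F_derivative:
  "\<alpha> \<noteq> \<beta> \<Longrightarrow> ((\<lambda>t. F t \<alpha> \<beta> a b) has_vector_derivative F1 (t, \<alpha>, \<beta>, a, b)) (at t)"
  using smooth_on_time_derivative[OF smooth_Fu open_off_diagonal, of t "(\<alpha>, \<beta>, a, b)"]
  by (simp add: Fu_def F1_def)

lemma sol_eq_F:
  assumes "sol x x'" "\<alpha> \<noteq> \<beta>"
  shows "x t = F t \<alpha> \<beta> (x \<alpha>) (x \<beta>)" "x' t = F1 (t, \<alpha>, \<beta>, x \<alpha>, x \<beta>)"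
proof -
  have eq: "x = (\<lambda>t. F t \<alpha> \<beta> (x \<alpha>) (x \<beta>))"
    using dependent assms unfolding smooth_dependence_def dependence_def complete_solution_iff by fastforce
  then show "x t = F t \<alpha> \<beta> (x \<alpha>) (x \<beta>)" by metis
  have "(x has_vector_derivative F1 (t, \<alpha>, \<beta>, x \<alpha>, x \<beta>)) (at t)"
    using F_derivative[OF assms(2)] eq by metis
  then show "x' t = F1 (t, \<alpha>, \<beta>, x \<alpha>, x \<beta>)"
    using assms(1) vector_derivative_unique_at unfolding sol_def by blast
qed

lemma
  assumes "\<alpha> \<noteq> \<beta>"
  shows sol_F: "sol (\<lambda>t. F t \<alpha> \<beta> a b) (\<lambda>t. F1 (t, \<alpha>, \<beta>, a, b))"
    and F_left: "F \<alpha> \<alpha> \<beta> a b = a" and F_right: "F \<beta> \<alpha> \<beta> a b = b"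
proof -
  obtain x x' where x: "sol x x'" "x \<alpha> = a" "x \<beta> = b"
    using solvable assms unfolding N_solvable_def complete_solution_iff by blast
  have "x = (\<lambda>t. F t \<alpha> \<beta> a b)" "x' = (\<lambda>t. F1 (t, \<alpha>, \<beta>, a, b))"
    using sol_eq_F[OF x(1) assms] x(2,3) by auto
  with x show "sol (\<lambda>t. F t \<alpha> \<beta> a b) (\<lambda>t. F1 (t, \<alpha>, \<beta>, a, b))"
    "F \<alpha> \<alpha> \<beta> a b = a" "F \<beta> \<alpha> \<beta> a b = b" by simp_all
qed

lemma F_consistent:
  "\<alpha> \<noteq> \<beta> \<Longrightarrow> \<gamma> \<noteq> \<delta> \<Longrightarrow> F \<tau> \<alpha> \<beta> a b = F \<tau> \<gamma> \<delta> (F \<gamma> \<alpha> \<beta> a b) (F \<delta> \<alpha> \<beta> a b)"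
  using sol_eq_F(1)[OF sol_F] .

section \<open>The initial velocity as a function of the value one time unit later\<close>

lemma continuous_F [continuous_intros]:
  assumes "continuous_on A t" "continuous_on A c" "continuous_on A d" "continuous_on A a" "continuous_on A b"
    "\<And>x. x \<in> A \<Longrightarrow> c x \<noteq> d x"
  shows "continuous_on A (\<lambda>x. F (t x) (c x) (d x) (a x) (b x))"
proof -
  have "continuous_on A (\<lambda>x. Fu (t x, c x, d x, a x, b x))"
    by (rule continuous_on_compose2[OF smooth_on_continuous[OF smooth_Fu open_off_diagonal]])
       (use assms in \<open>auto intro!: continuous_intros\<close>)
  then show ?thesis by (simp add: Fu_def)
qed

lemma continuous_F1 [continuous_intros]:
  assumes "continuous_on A t" "continuous_on A c" "continuous_on A d" "continuous_on A a" "continuous_on A b"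
    "\<And>x. x \<in> A \<Longrightarrow> c x \<noteq> d x"
  shows "continuous_on A (\<lambda>x. F1 (t x, c x, d x, a x, b x))"
  by (rule continuous_on_compose2[OF smooth_on_continuous[OF smooth_F1 open_off_diagonal]])
     (use assms in \<open>auto intro!: continuous_intros\<close>)

text \<open>Two solutions with common start \<open>a\<close> differ initially only in velocity and
  at \<alpha> + 1 by at least the norm of \<open>w - w'\<close>. Gronwall's inequality for the
  difference of their phase curves compares the two. The constant depends on \<open>r\<close>
  through a compact set containing all phase curves involved.\<close>

lemma initial_velocity_expanding:
  obtains C where "\<And>w w'. w \<in> cball 0 r \<Longrightarrow> w' \<in> cball 0 r \<Longrightarrow>
    norm (w - w') \<le> C * norm (F1 (\<alpha>, \<alpha>, \<alpha> + 1, a, w) - F1 (\<alpha>, \<alpha>, \<alpha> + 1, a, w'))"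
proof -
  define z where "z = (\<lambda>(t, w). (F t \<alpha> (\<alpha> + 1) a w, F1 (t, \<alpha>, \<alpha> + 1, a, w)))"
  have "continuous_on ({\<alpha>..\<alpha> + 1} \<times> cball 0 r) z"
    unfolding z_def case_prod_unfold by (intro continuous_intros) auto
  then have "bounded (z ` ({\<alpha>..\<alpha> + 1} \<times> cball 0 r))"
    by (intro compact_imp_bounded compact_continuous_image compact_Times) auto
  then obtain R where R: "\<And>t w. t \<in> {\<alpha>..\<alpha> + 1} \<Longrightarrow> w \<in> cball 0 r \<Longrightarrow> norm (z (t, w)) \<le> R"
    unfolding bounded_iff by blast
  obtain L where "L \<ge> 0" and L: "\<And>x y. x \<in> {\<alpha>..\<alpha> + 1} \<times> cball 0 R \<Longrightarrow> y \<in> {\<alpha>..\<alpha> + 1} \<times> cball 0 R \<Longrightarrow>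
      norm (f x - f y) \<le> L * norm (x - y)"
    by (rule smooth_on_lipschitz[OF smooth_f, of "{\<alpha>..\<alpha> + 1} \<times> cball 0 R"])
       (auto intro: compact_Times convex_Times)
  have "norm (w - w') \<le> exp (1 + L) * norm (F1 (\<alpha>, \<alpha>, \<alpha> + 1, a, w) - F1 (\<alpha>, \<alpha>, \<alpha> + 1, a, w'))"
    if w: "w \<in> cball 0 r" "w' \<in> cball 0 r" for w w'
  proof -
    let ?d = "\<lambda>t. z (t, w) - z (t, w')"
    let ?d' = "\<lambda>t. (snd (z (t, w)), f (t, z (t, w))) - (snd (z (t, w')), f (t, z (t, w')))"
    have z: "((\<lambda>t. z (t, w)) has_vector_derivative (snd (z (t, w)), f (t, z (t, w)))) (at t)" for t w
      using sol_F[of \<alpha> "\<alpha> + 1" a w] unfolding sol_def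
      by (auto simp: z_def intro!: has_vector_derivative_Pair)
    \<comment> \<open>In the rate \<open>1 + L\<close> the summand 1 accounts for the position
      component and \<open>L\<close> for the Lipschitz bound on \<open>f\<close>.\<close>
    have "norm (?d (\<alpha> + 1)) \<le> exp ((1 + L) * (\<alpha> + 1 - \<alpha>)) * norm (?d \<alpha>)"
    proof (rule gronwall_norm)
      show "(?d has_vector_derivative ?d' t) (at t)" for t
        by (intro has_vector_derivative_diff z)
      show "norm (?d' t) \<le> (1 + L) * norm (?d t)" if "t \<in> {\<alpha>..\<alpha> + 1}" for t
      proof -
        have "norm (f (t, z (t, w)) - f (t, z (t, w'))) \<le> L * norm (?d t)"
          using L[of "(t, z (t, w))" "(t, z (t, w'))"] R[OF that] w that by (simp add: norm_Pair)
        moreover have "norm (snd (?d t)) \<le> norm (?d t)"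
          by (metis norm_snd_le prod.collapse)
        moreover have "norm (?d' t) \<le> norm (snd (?d t)) + norm (f (t, z (t, w)) - f (t, z (t, w')))"
          using norm_Pair_le[of "snd (?d t)"] by simp
        ultimately show ?thesis by (simp add: algebra_simps)
      qed
    qed simp
    moreover have "norm (w - w') \<le> norm (?d (\<alpha> + 1))"
      by (simp add: z_def F_right norm_fst_le)
    moreover have "norm (?d \<alpha>) = norm (F1 (\<alpha>, \<alpha>, \<alpha> + 1, a, w) - F1 (\<alpha>, \<alpha>, \<alpha> + 1, a, w'))"
      by (simp add: z_def F_left norm_Pair)
    ultimately show ?thesis by simp
  qed
  then show ?thesis using that by blast
qed

text \<open>As long as a phase curve stays in the ball of radius \<open>R\<close> its speed is at
  most \<open>R + N\<close>. Hence it cannot move by a unit distance within a sufficiently short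
  time \<epsilon>, which is the same for all solutions considered.\<close>

lemma a_priori_bound:
  obtains \<epsilon> M where "\<epsilon> > 0"
    "\<And>x x'. sol x x' \<Longrightarrow> x \<alpha> = a \<Longrightarrow> norm (x' \<alpha> - v) \<le> 1 \<Longrightarrow> norm (x (\<alpha> + \<epsilon>)) \<le> M"
proof -
  \<comment> \<open>One unit allows for the deviation of the initial velocity from \<open>v\<close>,
    the other for the subsequent motion.\<close>
  define R where "R = norm (a, v) + 2"
  have "compact ({\<alpha>..\<alpha> + 1} \<times> cball (0 :: (real^'n) \<times> (real^'n)) R)"
    by (intro compact_Times) auto
  moreover have "continuous_on ({\<alpha>..\<alpha> + 1} \<times> cball 0 R) f"
    by (rule continuous_on_subset[OF smooth_on_continuous[OF smooth_f]]) auto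
  ultimately have "bounded (f ` ({\<alpha>..\<alpha> + 1} \<times> cball 0 R))"
    by (intro compact_imp_bounded compact_continuous_image)
  then obtain N where "N > 0" and N: "\<And>t y. t \<in> {\<alpha>..\<alpha> + 1} \<Longrightarrow> y \<in> cball 0 R \<Longrightarrow> norm (f (t, y)) \<le> N"
    unfolding bounded_pos by blast
  have "R > 0" by (simp add: R_def add_nonneg_pos)
  \<comment> \<open>The cap 1 keeps times in the interval on which \<open>N\<close> bounds
    \<open>f\<close>; the factor 2 makes the distance travelled strictly less than 1.\<close>
  define \<epsilon> where "\<epsilon> = min 1 (1 / (2 * (R + N)))"
  have "\<epsilon> > 0" "\<epsilon> \<le> 1" using \<open>R > 0\<close> \<open>N > 0\<close> by (auto simp: \<epsilon>_def)
  have \<epsilon>: "(R + N) * \<epsilon> < 1"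
  proof -
    have "(R + N) * \<epsilon> \<le> (R + N) * (1 / (2 * (R + N)))"
      using \<open>R > 0\<close> \<open>N > 0\<close> by (intro mult_left_mono) (auto simp: \<epsilon>_def)
    also have "\<dots> = 1 / 2" using \<open>R > 0\<close> \<open>N > 0\<close> by (simp add: field_simps)
    finally show ?thesis by simp
  qed
  have "norm (x (\<alpha> + \<epsilon>)) \<le> R" if x: "sol x x'" "x \<alpha> = a" "norm (x' \<alpha> - v) \<le> 1" for x x'
  proof -
    define z where "z t = (x t, x' t)" for t
    have der: "(z has_vector_derivative (x' t, f (t, z t))) (at t)" for t
      unfolding z_def using x(1) unfolding sol_def by (auto intro!: has_vector_derivative_Pair)
    have cont: "continuous_on A z" for A
      using der by (meson continuous_at_imp_continuous_on has_vector_derivative_continuous)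
    have near: "norm (z t) \<le> R" if "norm (z t - z \<alpha>) \<le> 1" for t
    proof -
      have "z \<alpha> = (a, v) + (0, x' \<alpha> - v)" using x(2) by (simp add: z_def)
      then have "norm (z \<alpha>) \<le> norm (a, v) + 1"
        using norm_triangle_ineq[of "(a, v)" "(0, x' \<alpha> - v)"] x(3) by (simp add: norm_Pair)
      then show ?thesis using norm_triangle_sub[of "z t" "z \<alpha>"] that by (simp add: R_def)
    qed
    have "norm (z (\<alpha> + \<epsilon>) - z \<alpha>) < 1"
    proof (rule ccontr)
      \<comment> \<open>The least element \<open>s\<close> of \<open>E\<close> is the first exit
        time from the unit ball around the start. Before \<open>s\<close> the speed bound holds, so
        the distance at \<open>s\<close> is still below 1, a contradiction.\<close>
      define E where "E = {t \<in> {\<alpha>..\<alpha> + \<epsilon>}. 1 \<le> norm (z t - z \<alpha>)}"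
      assume "\<not> norm (z (\<alpha> + \<epsilon>) - z \<alpha>) < 1"
      then have "E \<noteq> {}" using \<open>\<epsilon> > 0\<close> by (force simp: E_def)
      have "closed E"
      proof -
        have "E = {\<alpha>..\<alpha> + \<epsilon>} \<inter> {t. 1 \<le> norm (z t - z \<alpha>)}" by (auto simp: E_def)
        then show ?thesis by (auto intro!: closed_Int closed_Collect_le continuous_intros cont)
      qed
      moreover have "bounded E" by (rule bounded_subset[of "{\<alpha>..\<alpha> + \<epsilon>}"]) (auto simp: E_def)
      ultimately have "compact E" by (simp add: compact_eq_bounded_closed)
      then obtain s where s: "s \<in> E" and least: "\<And>t. t \<in> E \<Longrightarrow> s \<le> t"
        using compact_attains_inf[of E] \<open>E \<noteq> {}\<close> by blast
      from s have "\<alpha> \<le> s" "s \<le> \<alpha> + \<epsilon>" "1 \<le> norm (z s - z \<alpha>)" by (simp_all add: E_def)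
      then have "\<alpha> < s" by (cases "s = \<alpha>") simp_all
      have "norm (z s - z \<alpha>) \<le> (R + N) * s - (R + N) * \<alpha>"
      proof (rule differentiable_bound_general[OF \<open>\<alpha> < s\<close> cont _ der])
        show "continuous_on {\<alpha>..s} (\<lambda>t. (R + N) * t)" by (intro continuous_intros)
        show "((\<lambda>t. (R + N) * t) has_vector_derivative R + N) (at t)" for t
          by (auto intro!: derivative_eq_intros simp: has_vector_derivative_def)
        fix t assume t: "\<alpha> < t" "t < s"
        then have "t \<notin> E" using least by force
        then have "norm (z t - z \<alpha>) \<le> 1" using t \<open>s \<le> \<alpha> + \<epsilon>\<close> by (auto simp: E_def)
        then have "norm (z t) \<le> R" by (rule near)
        moreover have "norm (x' t) \<le> norm (z t)" unfolding z_def by (rule norm_snd_le)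
        moreover have "norm (f (t, z t)) \<le> N"
          using N[of t "z t"] \<open>norm (z t) \<le> R\<close> t \<open>s \<le> \<alpha> + \<epsilon>\<close> \<open>\<epsilon> \<le> 1\<close> by simp
        ultimately show "norm (x' t, f (t, z t)) \<le> R + N"
          using norm_Pair_le[of "x' t" "f (t, z t)"] by linarith
      qed
      also have "\<dots> \<le> (R + N) * \<epsilon>"
        using \<open>s \<le> \<alpha> + \<epsilon>\<close> \<open>R > 0\<close> \<open>N > 0\<close> by (simp add: right_diff_distrib[symmetric])
      finally show False using \<epsilon> \<open>1 \<le> norm (z s - z \<alpha>)\<close> by simp
    qed
    then have "norm (z (\<alpha> + \<epsilon>)) \<le> R" using near by simp
    then show ?thesis using norm_fst_le[of "x (\<alpha> + \<epsilon>)" "x' (\<alpha> + \<epsilon>)"] by (simp add: z_def)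
  qed
  then show ?thesis using that \<open>\<epsilon> > 0\<close> by blast
qed

lemma inj_initial_velocity: "inj (\<lambda>w. F1 (\<alpha>, \<alpha>, \<alpha> + 1, a, w))"
proof (rule injI)
  fix w w' assume eq: "F1 (\<alpha>, \<alpha>, \<alpha> + 1, a, w) = F1 (\<alpha>, \<alpha>, \<alpha> + 1, a, w')"
  obtain C where "\<And>u u'. u \<in> cball 0 (max (norm w) (norm w')) \<Longrightarrow> u' \<in> cball 0 (max (norm w) (norm w')) \<Longrightarrow>
    norm (u - u') \<le> C * norm (F1 (\<alpha>, \<alpha>, \<alpha> + 1, a, u) - F1 (\<alpha>, \<alpha>, \<alpha> + 1, a, u'))"
    using initial_velocity_expanding by blast
  from this[of w w'] show "w = w'" by (simp add: eq)
qed

text \<open>The attained initial velocities form an open set by invariance of domain. It is closed because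
  a priori solutions with velocities near a limit \<open>v\<close> stay bounded on a short interval
  \<open>[\<alpha>, \<alpha> + \<epsilon>]\<close>, so that their values at \<open>\<alpha> + \<epsilon>\<close> lie in a compact set of Neumann data.
  In particular no local existence theorem for initial value problems is needed.\<close>

lemma surj_initial_velocity: "surj (\<lambda>w. F1 (\<alpha>, \<alpha>, \<alpha> + 1, a, w))"
proof -
  let ?V = "range (\<lambda>w. F1 (\<alpha>, \<alpha>, \<alpha> + 1, a, w))"
  have "open ?V"
    by (rule invariance_of_domain[OF _ _ inj_initial_velocity]) (auto intro!: continuous_intros)
  moreover have "closed ?V"
  proof -
    have "v \<in> ?V" if v: "v \<in> closure ?V" for v
    proof -
      obtain \<epsilon> M where "\<epsilon> > 0" and M:
        "\<And>x x'. sol x x' \<Longrightarrow> x \<alpha> = a \<Longrightarrow> norm (x' \<alpha> - v) \<le> 1 \<Longrightarrow> norm (x (\<alpha> + \<epsilon>)) \<le> M"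
        using a_priori_bound[of \<alpha> a v] by blast
      let ?K = "(\<lambda>w. F1 (\<alpha>, \<alpha>, \<alpha> + \<epsilon>, a, w)) ` cball 0 M"
      have "compact ?K"
        using \<open>\<epsilon> > 0\<close> by (intro compact_continuous_image continuous_intros) auto
      have "ball v 1 \<inter> ?V \<subseteq> ?K"
      proof
        fix u assume "u \<in> ball v 1 \<inter> ?V"
        then obtain w where u: "u = F1 (\<alpha>, \<alpha>, \<alpha> + 1, a, w)" and "dist v u \<le> 1" by auto
        have s: "sol (\<lambda>t. F t \<alpha> (\<alpha> + 1) a w) (\<lambda>t. F1 (t, \<alpha>, \<alpha> + 1, a, w))"
          by (rule sol_F) simp
        have "norm (F (\<alpha> + \<epsilon>) \<alpha> (\<alpha> + 1) a w) \<le> M"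
          by (rule M[OF s]) (use \<open>dist v u \<le> 1\<close> u in \<open>auto simp: F_left dist_norm norm_minus_commute\<close>)
        moreover have "u = F1 (\<alpha>, \<alpha>, \<alpha> + \<epsilon>, a, F (\<alpha> + \<epsilon>) \<alpha> (\<alpha> + 1) a w)"
          using sol_eq_F(2)[OF s, of \<alpha> "\<alpha> + \<epsilon>" \<alpha>] \<open>\<epsilon> > 0\<close> by (simp add: u F_left)
        ultimately show "u \<in> ?K" by auto
      qed
      then have "closure (ball v 1 \<inter> ?V) \<subseteq> ?K"
        by (rule closure_minimal[OF _ compact_imp_closed[OF \<open>compact ?K\<close>]])
      moreover have "v \<in> closure (ball v 1 \<inter> ?V)"
        using open_Int_closure_subset[of "ball v 1" ?V] v by auto
      ultimately obtain w where w: "v = F1 (\<alpha>, \<alpha>, \<alpha> + \<epsilon>, a, w)" by blast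
      have s: "sol (\<lambda>t. F t \<alpha> (\<alpha> + \<epsilon>) a w) (\<lambda>t. F1 (t, \<alpha>, \<alpha> + \<epsilon>, a, w))"
        by (rule sol_F) (use \<open>\<epsilon> > 0\<close> in simp)
      \<comment> \<open>The solution found from data at \<alpha> and \<alpha> + \<epsilon> is
        complete, so its value at \<alpha> + 1 exists and shows that \<open>v\<close> is
        attained.\<close>
      have "v = F1 (\<alpha>, \<alpha>, \<alpha> + 1, a, F (\<alpha> + 1) \<alpha> (\<alpha> + \<epsilon>) a w)"
        using sol_eq_F(2)[OF s, of \<alpha> "\<alpha> + 1" \<alpha>] \<open>\<epsilon> > 0\<close> by (simp add: w F_left)
      then show ?thesis by blast
    qed
    then show ?thesis using closure_subset_eq by blast
  qed
  ultimately show ?thesis using clopen by blast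
qed

section \<open>The smooth global flow\<close>

definition "velocity = (\<lambda>((\<alpha>, a), w). F1 (\<alpha>, \<alpha>, \<alpha> + 1, a, w))"
text \<open>Time and position are grouped into one parameter, the shape required by
  \<open>smooth_on_parametric_inverse\<close>.\<close>

definition "endpoint = (\<lambda>((\<alpha>, a), v). inv (\<lambda>w. F1 (\<alpha>, \<alpha>, \<alpha> + 1, a, w)) v)"

lemma smooth_velocity: "smooth_on UNIV velocity"
  unfolding velocity_def case_prod_unfold
  by (rule smooth_on_compose[OF smooth_F1 open_off_diagonal]) (auto intro!: smooth_intros)

lemma velocity_endpoint: "velocity (p, endpoint (p, v)) = v"
  using surj_f_inv_f[OF surj_initial_velocity] by (cases p) (simp add: velocity_def endpoint_def)

lemma endpoint_velocity: "endpoint (p, velocity (p, w)) = w"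
  using inv_f_f[OF inj_initial_velocity] by (cases p) (simp add: velocity_def endpoint_def)

lemma smooth_endpoint: "smooth_on UNIV endpoint"
proof (rule smooth_on_parametric_inverse[OF smooth_velocity velocity_endpoint endpoint_velocity])
  fix p :: "real \<times> (real^'n)" and w k :: "real^'n"
  assume zero: "frechet_derivative velocity (at (p, w)) (0, k) = 0"
  \<comment> \<open>The radius \<open>norm w + 1\<close> covers the unit ball around
    \<open>w\<close>, where the expansion estimate is required.\<close>
  obtain C where C: "\<And>u u'. u \<in> cball 0 (norm w + 1) \<Longrightarrow> u' \<in> cball 0 (norm w + 1) \<Longrightarrow>
    norm (u - u') \<le> C * norm (velocity (p, u) - velocity (p, u'))"
    using initial_velocity_expanding[of "norm w + 1" "fst p" "snd p"]
    by (auto simp: velocity_def case_prod_unfold)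
  show "k = 0"
  proof (rule frechet_derivative_injective_if_expanding[OF smooth_velocity _ zero])
    fix w' :: "real^'n" assume "norm (w' - w) \<le> 1"
    then have "norm w' \<le> norm w + 1" using norm_triangle_sub[of w' w] by simp
    then show "norm (w' - w) \<le> C * norm (velocity (p, w') - velocity (p, w))" by (intro C) auto
  qed
qed

text \<open>The solution of the initial value problem, obtained by shooting: \<open>endpoint\<close>
  selects the value at \<alpha> + 1 that produces the initial velocity \<open>v\<close>.\<close>

definition "flow = (\<lambda>(\<tau>, \<alpha>, a, v). F \<tau> \<alpha> (\<alpha> + 1) a (endpoint ((\<alpha>, a), v)))"
definition "flow1 z = frechet_derivative flow (at z) (1, 0)"

lemma smooth_flow: "smooth_on UNIV flow"
proof -
  have "smooth_on UNIV (\<lambda>z. Fu (fst z, fst (snd z), fst (snd z) + 1, fst (snd (snd z)),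
      endpoint ((fst (snd z), fst (snd (snd z))), snd (snd (snd z)))))"
    by (rule smooth_on_compose[OF smooth_Fu open_off_diagonal])
       (auto intro!: smooth_intros smooth_on_compose[OF smooth_endpoint])
  then show ?thesis by (simp add: flow_def Fu_def case_prod_unfold)
qed

lemma smooth_flow1: "smooth_on UNIV flow1"
  unfolding flow1_def[abs_def] by (rule smooth_on_frechet_derivative[OF smooth_flow]) simp

lemma flow_derivative: "((\<lambda>t. flow (t, p)) has_vector_derivative flow1 (t, p)) (at t)"
  unfolding flow1_def by (rule smooth_on_time_derivative[OF smooth_flow]) auto

lemma flow1_eq: "flow1 (t, \<alpha>, a, v) = F1 (t, \<alpha>, \<alpha> + 1, a, endpoint ((\<alpha>, a), v))"
  by (rule vector_derivative_unique_at[OF flow_derivative]) (simp add: flow_def F_derivative)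

lemma sol_flow: "sol (\<lambda>t. flow (t, p)) (\<lambda>t. flow1 (t, p))"
  by (cases p) (simp add: flow_def flow1_eq sol_F)

lemma flow_initial: "flow (\<alpha>, \<alpha>, a, v) = a" "flow1 (\<alpha>, \<alpha>, a, v) = v"
  using velocity_endpoint[of "(\<alpha>, a)" v]
  by (simp_all add: flow_def flow1_eq F_left velocity_def)

text \<open>Uniqueness for the initial value problem: position and velocity at \<alpha> determine
  the value at \<alpha> + 1, and these Neumann data determine the solution.\<close>

lemma sol_eq_flow:
  assumes "sol x x'"
  shows "x t = flow (t, \<alpha>, x \<alpha>, x' \<alpha>)"
proof -
  have "x' \<alpha> = velocity ((\<alpha>, x \<alpha>), x (\<alpha> + 1))"
    using sol_eq_F(2)[OF assms, of \<alpha> "\<alpha> + 1"] by (simp add: velocity_def)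
  then have "endpoint ((\<alpha>, x \<alpha>), x' \<alpha>) = x (\<alpha> + 1)" using endpoint_velocity by metis
  moreover have "x t = F t \<alpha> (\<alpha> + 1) (x \<alpha>) (x (\<alpha> + 1))"
    by (rule sol_eq_F(1)[OF assms]) simp
  ultimately show ?thesis by (simp add: flow_def)
qed

section \<open>Mean velocities and the extension across the diagonal\<close>

text \<open>\<open>mean_velocity\<close> is the smooth extension across \<open>\<alpha> = \<beta>\<close> of the difference quotient of the solution
  with initial velocity \<open>w\<close>; \<open>shoot\<close> is its inverse in the last argument.\<close>

definition "mean_velocity =
  (\<lambda>((\<alpha>, \<beta>, a), w). integral {0..1} (\<lambda>s. flow1 (\<alpha> + s * (\<beta> - \<alpha>), \<alpha>, a, w)))"

definition "shoot = (\<lambda>((\<alpha>, \<beta>, a), v). if \<alpha> = \<beta> then v else F1 (\<alpha>, \<alpha>, \<beta>, a, a + (\<beta> - \<alpha>) *\<^sub>R v))"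

lemma smooth_mean_velocity: "smooth_on UNIV mean_velocity"
proof -
  define h where "h = (\<lambda>(((\<alpha>, \<beta>, a), w), s). flow1 (\<alpha> + s * (\<beta> - \<alpha>), \<alpha>, a, w))"
  have "smooth_on UNIV h"
    unfolding h_def case_prod_unfold
    by (rule smooth_on_compose[OF smooth_flow1]) (auto intro!: smooth_intros)
  from smooth_on_parametric_integral[OF this] show ?thesis
    by (simp add: mean_velocity_def h_def case_prod_unfold)
qed

text \<open>The fundamental theorem of calculus along the segment from \<alpha> to \<beta>, rescaled
  to the unit interval. Keeping the factor on the left makes the formula valid on the diagonal
  too.\<close>

lemma mean_velocity: "(\<beta> - \<alpha>) *\<^sub>R mean_velocity ((\<alpha>, \<beta>, a), w) = flow (\<beta>, \<alpha>, a, w) - a"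
proof -
  define x where "x s = flow (\<alpha> + s * (\<beta> - \<alpha>), \<alpha>, a, w)" for s
  define x' where "x' s = flow1 (\<alpha> + s * (\<beta> - \<alpha>), \<alpha>, a, w)" for s
  have "(x has_vector_derivative (\<beta> - \<alpha>) *\<^sub>R x' s) (at s within A)" for s A
  proof -
    have "((\<lambda>s. \<alpha> + s * (\<beta> - \<alpha>)) has_real_derivative (\<beta> - \<alpha>)) (at s)"
      by (auto intro!: derivative_eq_intros)
    then have "((\<lambda>s. \<alpha> + s * (\<beta> - \<alpha>)) has_vector_derivative (\<beta> - \<alpha>)) (at s)"
      by (simp add: has_real_derivative_iff_has_vector_derivative)
    from vector_diff_chain_at[OF this flow_derivative]
    show ?thesis unfolding x_def[abs_def] x'_def by (auto simp: o_def intro: has_vector_derivative_at_within)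
  qed
  then have "((\<lambda>s. (\<beta> - \<alpha>) *\<^sub>R x' s) has_integral (x 1 - x 0)) {0..1}"
    by (intro fundamental_theorem_of_calculus) auto
  then have "integral {0..1} (\<lambda>s. (\<beta> - \<alpha>) *\<^sub>R x' s) = x 1 - x 0" by (rule integral_unique)
  then show ?thesis
    by (simp add: x_def x'_def mean_velocity_def flow_initial)
qed

lemma mean_velocity_diag: "mean_velocity ((\<alpha>, \<alpha>, a), w) = w"
  by (simp add: mean_velocity_def flow_initial)

lemma flow_shoot:
  assumes "\<alpha> \<noteq> \<beta>"
  shows "flow (\<tau>, \<alpha>, a, shoot ((\<alpha>, \<beta>, a), v)) = F \<tau> \<alpha> \<beta> a (a + (\<beta> - \<alpha>) *\<^sub>R v)"
  using sol_eq_flow[OF sol_F[OF assms], of \<tau> a "a + (\<beta> - \<alpha>) *\<^sub>R v" \<alpha>] assms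
  by (simp add: shoot_def F_left)

lemma mean_velocity_shoot: "mean_velocity (p, shoot (p, v)) = v"
proof (cases p)
  case (fields \<alpha> \<beta> a)
  show ?thesis
  proof (cases "\<alpha> = \<beta>")
    case False
    then have "(\<beta> - \<alpha>) *\<^sub>R mean_velocity (p, shoot (p, v)) = (\<beta> - \<alpha>) *\<^sub>R v"
      by (simp add: fields mean_velocity flow_shoot F_right)
    then show ?thesis using False by simp
  qed (simp add: fields mean_velocity_diag shoot_def)
qed

lemma shoot_mean_velocity: "shoot (p, mean_velocity (p, w)) = w"
proof (cases p)
  case (fields \<alpha> \<beta> a)
  show ?thesis
  proof (cases "\<alpha> = \<beta>")
    case False
    have "shoot (p, mean_velocity (p, w)) = F1 (\<alpha>, \<alpha>, \<beta>, a, flow (\<beta>, \<alpha>, a, w))"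
      using False by (simp add: fields mean_velocity shoot_def)
    also have "\<dots> = w"
      using sol_eq_F(2)[OF sol_flow False, of \<alpha> "(\<alpha>, a, w)"] by (simp add: flow_initial)
    finally show ?thesis .
  qed (simp add: fields mean_velocity_diag shoot_def)
qed

text \<open>For fixed \<open>p\<close> the map \<open>shoot (p, _)\<close> is already known to be
  smooth: through \<open>F1\<close> off the diagonal, as the identity on it. Differentiating
  \<open>shoot (p, mean_velocity (p, w + t *\<^sub>R k)) = w + t *\<^sub>R k\<close> at
  \<open>t = 0\<close> therefore shows that the derivative of \<open>mean_velocity\<close> in its
  last argument is injective. Joint smoothness, in particular across \<alpha> = \<beta>, then comes
  from the parametric inverse.\<close>

lemma smooth_shoot: "smooth_on UNIV shoot"
proof (rule smooth_on_parametric_inverse[OF smooth_mean_velocity mean_velocity_shoot shoot_mean_velocity])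
  fix p :: "real \<times> real \<times> (real^'n)" and w k :: "real^'n"
  assume zero: "frechet_derivative mean_velocity (at (p, w)) (0, k) = 0"
  define c where "c t = mean_velocity (p, w + t *\<^sub>R k)" for t
  have shoot: "smooth_on UNIV (\<lambda>v. shoot (p, v))"
  proof (cases p)
    case (fields \<alpha> \<beta> a)
    show ?thesis
    proof (cases "\<alpha> = \<beta>")
      case False
      then show ?thesis
        by (auto simp: fields shoot_def intro!: smooth_intros smooth_on_compose[OF smooth_F1 open_off_diagonal])
    qed (simp add: fields shoot_def smooth_on_id)
  qed
  have lin: "linear (frechet_derivative (\<lambda>v. shoot (p, v)) (at (c 0)))"
    using smooth_on_has_derivative[OF shoot] has_derivative_linear by blast
  have "((\<lambda>t. (p, w + t *\<^sub>R k)) has_vector_derivative (0, k)) (at 0)"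
    by (auto intro!: has_vector_derivative_Pair derivative_eq_intros simp: has_vector_derivative_def)
  from smooth_on_chain_curve[OF smooth_mean_velocity _ this]
  have "(c has_vector_derivative 0) (at 0)" by (simp add: zero c_def[abs_def])
  from smooth_on_chain_curve[OF shoot _ this]
  have "((\<lambda>t. shoot (p, c t)) has_vector_derivative 0) (at 0)" by (simp add: linear_0[OF lin])
  then have "((\<lambda>t. w + t *\<^sub>R k) has_vector_derivative 0) (at 0)"
    by (simp add: c_def shoot_mean_velocity)
  moreover have "((\<lambda>t. w + t *\<^sub>R k) has_vector_derivative k) (at 0)"
    by (auto intro!: derivative_eq_intros simp: has_vector_derivative_def)
  ultimately show "k = 0" using vector_derivative_unique_at by blast
qed

lemma smooth_extension:
  "smooth_on UNIV (\<lambda>(\<tau>, \<alpha>, \<beta>, a, v). flow (\<tau>, \<alpha>, a, shoot ((\<alpha>, \<beta>, a), v)))"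
  unfolding case_prod_unfold
  by (rule smooth_on_compose[OF smooth_flow])
     (auto intro!: smooth_intros smooth_on_compose[OF smooth_shoot])

end

section \<open>The characterization\<close>

theorem mainTheorem3:
  fixes F :: "real \<Rightarrow> real \<Rightarrow> real \<Rightarrow> real^'n \<Rightarrow> real^'n \<Rightarrow> real^'n"
  shows "(\<exists>f :: real \<times> (real^'n) \<times> (real^'n) \<Rightarrow> real^'n.
            smooth_on UNIV f \<and> N_solvable f \<and> smooth_dependence F f)
    \<longleftrightarrow>
    ((\<forall>\<tau> \<gamma> \<delta> \<alpha> \<beta> a b. \<alpha> \<noteq> \<beta> \<and> \<gamma> \<noteq> \<delta> \<longrightarrow>
        F \<tau> \<alpha> \<beta> a b = F \<tau> \<gamma> \<delta> (F \<gamma> \<alpha> \<beta> a b) (F \<delta> \<alpha> \<beta> a b)) \<and>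
     (\<forall>\<alpha> \<beta> a b. \<alpha> \<noteq> \<beta> \<longrightarrow> F \<alpha> \<alpha> \<beta> a b = a \<and> F \<beta> \<alpha> \<beta> a b = b) \<and>
     (\<exists>S :: real \<times> real \<times> real \<times> (real^'n) \<times> (real^'n) \<Rightarrow> real^'n.
        smooth_on UNIV S \<and>
        (\<forall>\<tau> \<alpha> \<beta> a v. \<alpha> \<noteq> \<beta> \<longrightarrow>
           S (\<tau>, \<alpha>, \<beta>, a, v) = F \<tau> \<alpha> \<beta> a (a + (\<beta> - \<alpha>) *\<^sub>R v))))"
    (is "(\<exists>f. ?N f) \<longleftrightarrow> ?i \<and> ?ii \<and> (\<exists>S. ?iii S)")
proof
  assume "\<exists>f. ?N f"
  then obtain f where "?N f" ..
  then interpret neumann_equation f F by unfold_locales auto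
  \<comment> \<open>Start with the velocity whose mean over the interval from \<alpha> to \<beta> is
    \<open>v\<close>; off the diagonal this is the solution given by \<open>F\<close>.\<close>
  have "?iii (\<lambda>(\<tau>, \<alpha>, \<beta>, a, v). flow (\<tau>, \<alpha>, a, shoot ((\<alpha>, \<beta>, a), v)))"
    using smooth_extension by (simp add: flow_shoot)
  then show "?i \<and> ?ii \<and> (\<exists>S. ?iii S)"
    by (intro conjI exI allI impI) (auto intro: F_consistent simp: F_left F_right)
next
  assume *: "?i \<and> ?ii \<and> (\<exists>S. ?iii S)"
  note i = conjunct1[OF *, rule_format, OF conjI] and ii = conjunct1[OF conjunct2[OF *], rule_format]
  from conjunct2[OF conjunct2[OF *]] obtain S where S: "?iii S" ..
  interpret neumann_extension F S
    by unfold_locales (fact i, fact ii[THEN conjunct1], fact ii[THEN conjunct2],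
        fact S[THEN conjunct1], fact S[THEN conjunct2, rule_format])
  show "\<exists>f. ?N f" using smooth_rhs N_solvable_rhs smooth_dependence_rhs by blast
qed

end
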